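(* Let $\mathbf{k}$ be a field. For every $n\geq 1$, the linear endomorphism $\tau$ of $\mathcal{Y}(n)=\mathbf{k}\mathbb{Y}(n)$ given by the anticyclic structure of the dendriform operad and the linear endomorphism $\theta$ of the same space given by the Coxeter transformation of the Tamari poset $\mathbb{T}(n)$ satisfy $$\tau=(-1)^n\,\theta^2 .$$
   Context: Planar binary trees. $\mathbb{Y}(n)$ is the set of (rooted) planar binary trees with $n$ trivalent vertices and $n+1$ leaves ($n\ge 0$); $n$ is called the degree. $|$ is the unique tree of degree $0$, $Y$ the unique tree of degree $1$. $\mathbb{Y}=\bigsqcup_{n\ge0}\mathbb{Y}(n)$ and $\mathbb{Y}^+=\mathbb{Y}\setminus\{|\}$. For $S,T\in\mathbb{Y}$, $S_YT$ is the tree obtained by grafting $S$ on the left leaf and $T$ on the right leaf of $Y$; every tree in $\mathbb{Y}^+$ is uniquely of this form. $S/T$ is obtained by grafting the root of $S$ on the leftmost leaf of $T$; $S\backslash T$ by grafting the root of $T$ on the rightmost leaf of $S$. In particular $\mathbb{Y}(2)=\{Y/Y,\,Y\backslash Y\}$. Tamari poset. $\mathbb{T}(n)$ is the set $\mathbb{Y}(n)$ with the partial order $\leq$ that is the reflexive transitive closure of the relations $S< T$ whenever $T$ is obtained from $S$ by replacing one subtree of the form $(A_YB)_YC$ by $A_Y(B_YC)$ (with $A,B,C\in\mathbb{Y}$). For $n=2$: $Y/Y<Y\backslash Y$. Coxeter transformation. For a finite poset $P$, let $L$ be the matrix with $L_{v,w}=1$ if $v\le w$ and $0$ otherwise ($v,w\in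 P$). The Coxeter transformation is the map induced by the Auslander–Reiten translation on the Grothendieck group $K_0$ of the bounded derived category of modules over the Hasse quiver of $P$ (arrows $v\to w$ for $w$ covering $v$) with all commutativity relations; in the basis of classes of simple modules, indexed by $P$, its matrix (acting on column vectors) is $\theta=-L(L^t)^{-1}$. Thus $L$ sends $w$ to $\sum_{v\le w}v$ and $L^t$ sends $v$ to $\sum_{w\ge v}w$. For $P=\mathbb{T}(n)$, $\theta$ is regarded as a linear endomorphism of $\mathbf{k}\mathbb{Y}(n)$. Dendriform operad. A dendriform algebra is a vector space with bilinear operations $\prec,\succ$ satisfying $(x\prec y)\prec z=x\prec(y\prec z)+x\prec(y\succ z)$, $x\succ(y\prec z)=(x\succ y)\prec z$, $x\succ(y\succ z)=(x\succ y)\succ z+(x\prec y)\succ z$. The dendriform operad $\mathcal{Y}$ is the non-symmetric operad over $\mathbf{k}$ generated by two binary operations $\prec,\succ$ subject to these relations. The free dendriform algebra on one generator $Y$ is $\mathbf{k}\mathbb{Y}^+$ with, for $S=S^1{}_YS^2$ and $T=T^1{}_YT^2$, $S\prec T=S^1{}_Y(S^2*T)$ and $S\succ T=(S*T^1)_YT^2$, where $*=\prec+\succ$ on $\mathbf{k}\mathbb{Y}^+$ and $|$ is a two-sided unit for $*$. One identifies $\mathcal{Y}(n)$ with $\mathbf{k}\mathbb{Y}(n)$, $n\ge1$, by $\mu\mapsto\mu(Y,\dots,Y)$; so the operad unit is $Y$, $\prec$ is $Y\backslash Y$ and $\succ$ is $Y/Y$. The partial composition is $(\mu\circ_i\nu)(x_1,\dots,x_{n+m-1})=\mu(x_1,\dots,x_{i-1},\nu(x_i,\dots,x_{i+m-1}),x_{i+m},\dots,x_{n+m-1})$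 for $\mu\in\mathcal{Y}(n)$, $\nu\in\mathcal{Y}(m)$, $1\le i\le n$. Anticyclic structure. An anticyclic non-symmetric operad $\mathcal{P}$ is a non-symmetric operad (with unit $1$) with a linear map $\tau$ on each $\mathcal{P}(n)$, $n\ge1$, such that $\tau^{n+1}=\mathrm{Id}$ on $\mathcal{P}(n)$, $\tau(1)=-1$, and for $a\in\mathcal{P}(n)$, $b\in\mathcal{P}(m)$: $\tau(a\circ_nb)=-\tau(b)\circ_1\tau(a)$ and $\tau(a\circ_ib)=\tau(a)\circ_{i+1}b$ for $1\le i<n$. It is known that there is a unique anticyclic structure $\tau$ on $\mathcal{Y}$ with $\tau(Y\backslash Y)=Y/Y$ and $\tau(Y/Y)=-(Y\backslash Y+Y/Y)$; this is the $\tau$ in the statement. *)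

theory Defs
  imports "HOL-Library.Poly_Mapping"
begin

section \<open>Free modules on a set\<close>

definition smul :: "'k::field \<Rightarrow> ('a \<Rightarrow>\<^sub>0 'k) \<Rightarrow> ('a \<Rightarrow>\<^sub>0 'k)" where
  "smul c a = Poly_Mapping.map ((*) c) a"

definition basis :: "'a \<Rightarrow> ('a \<Rightarrow>\<^sub>0 'k::field)" where
  "basis x = Poly_Mapping.single x 1"

definition free_on :: "'a set \<Rightarrow> ('a \<Rightarrow>\<^sub>0 'k::field) set" where
  "free_on P = {a. Poly_Mapping.keys a \<subseteq> P}"

definition lin :: "('a \<Rightarrow> ('b \<Rightarrow>\<^sub>0 'k)) \<Rightarrow> ('a \<Rightarrow>\<^sub>0 'k::field) \<Rightarrow> ('b \<Rightarrow>\<^sub>0 'k)" where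
  "lin f a = (\<Sum>x\<in>Poly_Mapping.keys a. smul (Poly_Mapping.lookup a x) (f x))"

lemma lookup_smul [simp]: "Poly_Mapping.lookup (smul c a) x = c * Poly_Mapping.lookup a x"
  unfolding smul_def by transfer (simp add: when_def)

lemma lookup_basis: "Poly_Mapping.lookup (basis x) y = (if x = y then 1 else 0)"
  by (simp add: basis_def lookup_single when_def)

lemma lookup_lin:
  assumes "finite A" "Poly_Mapping.keys a \<subseteq> A"
  shows "Poly_Mapping.lookup (lin f a) y
    = (\<Sum>x\<in>A. Poly_Mapping.lookup a x * Poly_Mapping.lookup (f x) y)"
  unfolding lin_def lookup_sum lookup_smul
  by (rule sum.mono_neutral_left) (use assms in \<open>auto simp: in_keys_iff\<close>)

lemma lin_add: "lin f (a + b) = lin f a + lin f b"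
proof (rule poly_mapping_eqI)
  fix y
  let ?A = "Poly_Mapping.keys a \<union> Poly_Mapping.keys b"
  have A: "finite ?A" "Poly_Mapping.keys a \<subseteq> ?A" "Poly_Mapping.keys b \<subseteq> ?A"
    "Poly_Mapping.keys (a + b) \<subseteq> ?A" using Poly_Mapping.keys_add[of a b] by auto
  show "Poly_Mapping.lookup (lin f (a + b)) y = Poly_Mapping.lookup (lin f a + lin f b) y"
    by (simp only: lookup_add lookup_lin[OF A(1,2)] lookup_lin[OF A(1,3)] lookup_lin[OF A(1,4)])
      (simp add: algebra_simps sum.distrib)
qed

lemma lin_smul: "lin f (smul c a) = smul c (lin f a)"
proof (rule poly_mapping_eqI)
  fix y
  have A: "finite (Poly_Mapping.keys a)" "Poly_Mapping.keys a \<subseteq> Poly_Mapping.keys a"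
    "Poly_Mapping.keys (smul c a) \<subseteq> Poly_Mapping.keys a"
    by (auto simp: in_keys_iff)
  show "Poly_Mapping.lookup (lin f (smul c a)) y = Poly_Mapping.lookup (smul c (lin f a)) y"
    by (simp only: lookup_smul lookup_lin[OF A(1,2)] lookup_lin[OF A(1,3)])
      (simp add: sum_distrib_left mult.assoc)
qed

lemma lin_zero [simp]: "lin f 0 = 0"
  by (simp add: lin_def)

lemma lin_sum: "lin f (sum g A) = (\<Sum>i\<in>A. lin f (g i))"
  by (induction A rule: infinite_finite_induct) (auto simp: lin_add)

lemma smul_one [simp]: "smul 1 a = a"
  by (rule poly_mapping_eqI) simp

lemma lin_basis [simp]: "lin f (basis x) = f x"
  by (simp add: lin_def basis_def)

lemma smul_zero [simp]: "smul c 0 = 0"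
  by (rule poly_mapping_eqI) simp

lemma smul_add: "smul c (a + b) = smul c a + smul c b"
  by (rule poly_mapping_eqI) (simp add: lookup_add algebra_simps)

lemma smul_sum: "smul c (sum g A) = (\<Sum>i\<in>A. smul c (g i))"
  by (induction A rule: infinite_finite_induct) (auto simp: smul_add)

lemma smul_smul: "smul c (smul d a) = smul (c * d) a"
  by (rule poly_mapping_eqI) (simp add: mult.assoc)

lemma lin_lin: "lin f (lin g a) = lin (\<lambda>x. lin f (g x)) a"
  by (simp add: lin_def[of g] lin_def[of "\<lambda>x. lin f (g x)"] lin_sum lin_smul)

lemma lin_add_fun: "lin (\<lambda>x. f x + g x) a = lin f a + lin g a"
  by (simp add: lin_def smul_add sum.distrib)

lemma lin_smul_fun: "lin (\<lambda>x. smul c (f x)) a = smul c (lin f a)"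
  by (simp add: lin_def smul_sum smul_smul mult.commute)

lemma lin_id [simp]: "lin basis a = a"
  by (rule poly_mapping_eqI)
    (auto simp: lookup_lin[OF finite_keys order.refl] lookup_basis in_keys_iff if_distrib cong: if_cong)

lemma lin_cong: "(\<And>x. x \<in> Poly_Mapping.keys a \<Longrightarrow> f x = g x) \<Longrightarrow> lin f a = lin g a"
  by (simp add: lin_def)

lemma lin_swap: "lin (\<lambda>x. lin (\<lambda>y. f x y) b) a = lin (\<lambda>y. lin (\<lambda>x. f x y) a) b"
  unfolding lin_def smul_sum
  by (subst sum.swap) (simp add: smul_smul mult.commute)

lemma free_on_basis: "x \<in> P \<Longrightarrow> basis x \<in> free_on P"
  by (auto simp: free_on_def basis_def)

lemma free_on_zero: "0 \<in> free_on P"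
  by (auto simp: free_on_def)

lemma free_on_add: "a \<in> free_on P \<Longrightarrow> b \<in> free_on P \<Longrightarrow> a + b \<in> free_on P"
  using Poly_Mapping.keys_add[of a b] by (auto simp: free_on_def)

lemma free_on_smul: "a \<in> free_on P \<Longrightarrow> smul c a \<in> free_on P"
  by (auto simp: free_on_def in_keys_iff)

lemma free_on_sum: "(\<And>i. i \<in> A \<Longrightarrow> g i \<in> free_on P) \<Longrightarrow> sum g A \<in> free_on P"
  by (induction A rule: infinite_finite_induct) (auto simp: free_on_add free_on_zero)

lemma free_on_lin: "a \<in> free_on P \<Longrightarrow> (\<And>x. x \<in> P \<Longrightarrow> f x \<in> free_on Q) \<Longrightarrow> lin f a \<in> free_on Q"
  unfolding lin_def by (rule free_on_sum) (auto simp: free_on_def[of P] intro!: free_on_smul)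


section \<open>Coxeter transformation of a finite poset\<close>

definition incidence :: "('a \<Rightarrow> 'a \<Rightarrow> bool) \<Rightarrow> 'a \<Rightarrow> 'a \<Rightarrow> 'k::field" where
  "incidence le v w = (if le v w then 1 else 0)"

definition mat_apply :: "'a set \<Rightarrow> ('a \<Rightarrow> 'a \<Rightarrow> 'k) \<Rightarrow> ('a \<Rightarrow>\<^sub>0 'k) \<Rightarrow> ('a \<Rightarrow>\<^sub>0 'k::field)" where
  "mat_apply P M a = (\<Sum>v\<in>P. \<Sum>w\<in>P. smul (M v w * Poly_Mapping.lookup a w) (basis v))"

text \<open>The matrix \<open>- L (L\<^sup>t)\<^sup>-\<^sup>1\<close> acting on column vectors; that \<open>L\<^sup>t\<close> is indeed invertible
  on the free module on a finite poset is \<open>bij_incidence_transpose\<close> below.\<close>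

definition coxeter :: "'a set \<Rightarrow> ('a \<Rightarrow> 'a \<Rightarrow> bool) \<Rightarrow> ('a \<Rightarrow>\<^sub>0 'k) \<Rightarrow> ('a \<Rightarrow>\<^sub>0 'k::field)" where
  "coxeter P le a =
     - mat_apply P (incidence le)
         (inv_into (free_on P) (mat_apply P (\<lambda>v w. incidence le w v)) a)"

lemma lookup_mat_apply:
  assumes "finite P"
  shows "Poly_Mapping.lookup (mat_apply P M a) v
    = (if v \<in> P then \<Sum>w\<in>P. M v w * Poly_Mapping.lookup a w else 0)"
proof -
  have "Poly_Mapping.lookup (mat_apply P M a) v
    = (\<Sum>u\<in>P. if u = v then \<Sum>w\<in>P. M v w * Poly_Mapping.lookup a w else 0)"
    by (auto simp: mat_apply_def lookup_sum lookup_basis intro!: sum.cong)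
  then show ?thesis using assms by simp
qed

lemma mat_apply_add: "finite P \<Longrightarrow> mat_apply P M (a + b) = mat_apply P M a + mat_apply P M b"
  by (rule poly_mapping_eqI) (simp add: lookup_mat_apply lookup_add algebra_simps sum.distrib)

lemma mat_apply_smul: "finite P \<Longrightarrow> mat_apply P M (smul c a) = smul c (mat_apply P M a)"
  by (rule poly_mapping_eqI) (simp add: lookup_mat_apply sum_distrib_left mult.left_commute)

lemma mat_apply_sum: "finite P \<Longrightarrow> mat_apply P M (sum g A) = (\<Sum>i\<in>A. mat_apply P M (g i))"
proof -
  assume "finite P"
  moreover from this have "mat_apply P M 0 = 0"
    by (intro poly_mapping_eqI) (simp add: lookup_mat_apply)
  ultimately show ?thesis
    by (induction A rule: infinite_finite_induct) (auto simp: mat_apply_add)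
qed

lemma mat_apply_in_free_on: "finite P \<Longrightarrow> mat_apply P M a \<in> free_on P"
  by (auto simp: free_on_def in_keys_iff lookup_mat_apply split: if_splits)

lemma bij_incidence_transpose:
  fixes le :: "'a \<Rightarrow> 'a \<Rightarrow> bool"
  assumes fin: "finite P"
    and refl: "\<And>x. x \<in> P \<Longrightarrow> le x x"
    and antisym: "\<And>x y. x \<in> P \<Longrightarrow> y \<in> P \<Longrightarrow> le x y \<Longrightarrow> le y x \<Longrightarrow> x = y"
    and trans: "\<And>x y z. x \<in> P \<Longrightarrow> y \<in> P \<Longrightarrow> z \<in> P \<Longrightarrow> le x y \<Longrightarrow> le y z \<Longrightarrow> le x z"
  shows "bij_betw (mat_apply P (\<lambda>v w. incidence le w v) :: ('a \<Rightarrow>\<^sub>0 'k::field) \<Rightarrow> _)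
    (free_on P) (free_on P)" (is "bij_betw ?f _ _")
proof -
  have lk: "Poly_Mapping.lookup (?f a) v
      = (if v \<in> P then Poly_Mapping.lookup a v
          + (\<Sum>w\<in>{w\<in>P. le w v \<and> w \<noteq> v}. Poly_Mapping.lookup a w) else 0)" for a v
  proof (cases "v \<in> P")
    case True
    have "(\<Sum>w\<in>P. incidence le w v * Poly_Mapping.lookup a w)
        = (\<Sum>w\<in>{w\<in>P. le w v}. Poly_Mapping.lookup a w)"
      unfolding incidence_def using fin
      by (simp add: if_distrib[of "\<lambda>c. c * _"] sum.If_cases Int_def cong: if_cong)
    also have "{w\<in>P. le w v} = insert v {w\<in>P. le w v \<and> w \<noteq> v}" using True refl by auto
    finally show ?thesis using True fin by (simp add: lookup_mat_apply)
  qed (use fin in \<open>simp add: lookup_mat_apply\<close>)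
  have inj: "a = b" if ab: "a \<in> free_on P" "b \<in> free_on P" "?f a = ?f b" for a b
  proof -
    have eq: "Poly_Mapping.lookup a v = Poly_Mapping.lookup b v" if "v \<in> P" for v
      using that
    proof (induction "card {w\<in>P. le w v \<and> w \<noteq> v}" arbitrary: v rule: less_induct)
      case (less v)
      have "Poly_Mapping.lookup a w = Poly_Mapping.lookup b w"
        if w: "w \<in> {w\<in>P. le w v \<and> w \<noteq> v}" for w
      proof (rule less.hyps)
        have "{u\<in>P. le u w \<and> u \<noteq> w} \<subset> {u\<in>P. le u v \<and> u \<noteq> v}"
        proof (rule psubsetI)
          show "{u\<in>P. le u w \<and> u \<noteq> w} \<subseteq> {u\<in>P. le u v \<and> u \<noteq> v}"
            using w less.prems trans antisym by blast
          show "{u\<in>P. le u w \<and> u \<noteq> w} \<noteq> {u\<in>P. le u v \<and> u \<noteq> v}"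
            using w by blast
        qed
        then show "card {u\<in>P. le u w \<and> u \<noteq> w} < card {u\<in>P. le u v \<and> u \<noteq> v}"
          using fin by (intro psubset_card_mono) auto
      qed (use w in auto)
      then have "(\<Sum>w\<in>{w\<in>P. le w v \<and> w \<noteq> v}. Poly_Mapping.lookup a w)
          = (\<Sum>w\<in>{w\<in>P. le w v \<and> w \<noteq> v}. Poly_Mapping.lookup b w)"
        by (rule sum.cong[OF HOL.refl])
      then show ?case using lk[of a v] lk[of b v] ab(3) less.prems by simp
    qed
    show "a = b"
    proof (rule poly_mapping_eqI)
      fix v
      show "Poly_Mapping.lookup a v = Poly_Mapping.lookup b v"
      proof (cases "v \<in> P")
        case False
        then have "v \<notin> Poly_Mapping.keys a" "v \<notin> Poly_Mapping.keys b"
          using ab(1,2) by (auto simp: free_on_def)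
        then show ?thesis by (simp add: in_keys_iff)
      qed (rule eq)
    qed
  qed
  have sur: "\<exists>a\<in>free_on P. ?f a = basis v" if "v \<in> P" for v
    using that
  proof (induction "card {w\<in>P. le v w \<and> w \<noteq> v}" arbitrary: v rule: less_induct)
    case (less v)
    let ?U = "{w\<in>P. le v w \<and> w \<noteq> v}"
    have "\<exists>a\<in>free_on P. ?f a = basis w" if w: "w \<in> ?U" for w
    proof (rule less.hyps)
      have "{u\<in>P. le w u \<and> u \<noteq> w} \<subset> ?U"
      proof (rule psubsetI)
        show "{u\<in>P. le w u \<and> u \<noteq> w} \<subseteq> ?U"
          using w less.prems trans antisym by blast
        show "{u\<in>P. le w u \<and> u \<noteq> w} \<noteq> ?U" using w by blast
      qed
      then show "card {u\<in>P. le w u \<and> u \<noteq> w} < card ?U"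
        using fin by (intro psubset_card_mono) auto
    qed (use w in auto)
    then have "\<forall>w\<in>?U. \<exists>a. a \<in> free_on P \<and> ?f a = basis w" by blast
    from bchoice[OF this] obtain g where "\<forall>w\<in>?U. g w \<in> free_on P \<and> ?f (g w) = basis w" ..
    then have g: "\<And>w. w \<in> ?U \<Longrightarrow> g w \<in> free_on P" "\<And>w. w \<in> ?U \<Longrightarrow> ?f (g w) = basis w"
      by blast+
    let ?a = "basis v + smul (- 1) (sum g ?U)"
    have "?f (basis v) = basis v + (\<Sum>w\<in>?U. basis w)"
    proof (rule poly_mapping_eqI)
      fix u
      have "(\<Sum>w\<in>{w\<in>P. le w u \<and> w \<noteq> u}. if v = w then 1 else 0 :: 'k)
          = (if le v u \<and> v \<noteq> u then 1 else 0)"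
        using fin less.prems by (simp add: sum.delta)
      moreover have "(\<Sum>w\<in>?U. if w = u then 1 else 0 :: 'k)
          = (if u \<in> ?U then 1 else 0)"
        using fin by (simp add: sum.delta)
      ultimately show "Poly_Mapping.lookup (?f (basis v)) u
          = Poly_Mapping.lookup (basis v + (\<Sum>w\<in>?U. basis w)) u"
        using less.prems by (auto simp: lk lookup_add lookup_sum lookup_basis)
    qed
    moreover have "?f (sum g ?U) = (\<Sum>w\<in>?U. basis w)"
      using fin g(2) by (simp add: mat_apply_sum)
    ultimately have "?f ?a = basis v"
      using fin by (simp add: mat_apply_add mat_apply_smul)
        (rule poly_mapping_eqI, simp add: lookup_add)
    moreover have "?a \<in> free_on P"
      using g(1) less.prems by (intro free_on_add free_on_smul free_on_sum free_on_basis)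
    ultimately show ?case by blast
  qed
  then have "\<forall>v\<in>P. \<exists>a. a \<in> free_on P \<and> ?f a = basis v" by blast
  from bchoice[OF this] obtain g where "\<forall>v\<in>P. g v \<in> free_on P \<and> ?f (g v) = basis v" ..
  then have g: "\<And>v. v \<in> P \<Longrightarrow> g v \<in> free_on P" "\<And>v. v \<in> P \<Longrightarrow> ?f (g v) = basis v"
    by blast+
  show ?thesis
  proof (rule bij_betwI')
    show "?f x = ?f y \<longleftrightarrow> x = y" if "x \<in> free_on P" "y \<in> free_on P" for x y
      using inj that by blast
    show "?f x \<in> free_on P" for x by (rule mat_apply_in_free_on[OF fin])
    show "\<exists>x\<in>free_on P. y = ?f x" if "y \<in> free_on P" for y
    proof
      have "?f (lin g y) = lin (\<lambda>v. ?f (g v)) y"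
        by (simp add: lin_def mat_apply_sum[OF fin] mat_apply_smul[OF fin])
      also have "\<dots> = lin basis y"
        using that g(2) by (intro lin_cong) (auto simp: free_on_def)
      finally show "y = ?f (lin g y)" by simp
      show "lin g y \<in> free_on P" using that g(1) by (rule free_on_lin)
    qed
  qed
qed


section \<open>Planar binary trees and the Tamari order\<close>

datatype pbtree = Lf | Nd pbtree pbtree

primrec degree :: "pbtree \<Rightarrow> nat" where
  "degree Lf = 0"
| "degree (Nd S T) = degree S + degree T + 1"

definition trees :: "nat \<Rightarrow> pbtree set" where
  "trees n = {T. degree T = n}"

definition Ytree :: pbtree where
  "Ytree = Nd Lf Lf"

text \<open>\<open>tree_over S T\<close> is \<open>S / T\<close> and \<open>tree_under S T\<close> is \<open>S \ T\<close>.\<close>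

primrec tree_over :: "pbtree \<Rightarrow> pbtree \<Rightarrow> pbtree" where
  "tree_over S Lf = S"
| "tree_over S (Nd T1 T2) = Nd (tree_over S T1) T2"

primrec tree_under :: "pbtree \<Rightarrow> pbtree \<Rightarrow> pbtree" where
  "tree_under Lf T = T"
| "tree_under (Nd S1 S2) T = Nd S1 (tree_under S2 T)"

inductive tamari_step :: "pbtree \<Rightarrow> pbtree \<Rightarrow> bool" where
  rotate: "tamari_step (Nd (Nd A B) C) (Nd A (Nd B C))"
| left: "tamari_step S S' \<Longrightarrow> tamari_step (Nd S T) (Nd S' T)"
| right: "tamari_step T T' \<Longrightarrow> tamari_step (Nd S T) (Nd S T')"

definition tamari_le :: "pbtree \<Rightarrow> pbtree \<Rightarrow> bool" where
  "tamari_le = tamari_step\<^sup>*\<^sup>*"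

lemma finite_trees: "finite (trees n)"
proof (induction n rule: less_induct)
  case (less n)
  have "trees n \<subseteq> insert Lf (\<Union>i<n. \<Union>j<n. (\<lambda>(S, T). Nd S T) ` (trees i \<times> trees j))"
  proof
    fix T assume "T \<in> trees n"
    then show "T \<in> insert Lf (\<Union>i<n. \<Union>j<n. (\<lambda>(S, T). Nd S T) ` (trees i \<times> trees j))"
      by (cases T) (force simp: trees_def)+
  qed
  moreover have "finite (insert Lf (\<Union>i<n. \<Union>j<n. (\<lambda>(S, T). Nd S T) ` (trees i \<times> trees j)))"
    using less by auto
  ultimately show ?case by (rule finite_subset)
qed

lemma tamari_le_refl: "tamari_le T T"
  by (simp add: tamari_le_def)

lemma tamari_le_trans: "tamari_le S T \<Longrightarrow> tamari_le T U \<Longrightarrow> tamari_le S U"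
  by (simp add: tamari_le_def)

lemma tamari_step_degree: "tamari_step S T \<Longrightarrow> degree S = degree T"
  by (induction rule: tamari_step.induct) auto

primrec left_weight :: "pbtree \<Rightarrow> nat" where
  "left_weight Lf = 0"
| "left_weight (Nd S T) = degree S + left_weight S + left_weight T"

lemma tamari_step_left_weight: "tamari_step S T \<Longrightarrow> left_weight T < left_weight S"
  by (induction rule: tamari_step.induct) (auto dest: tamari_step_degree)

lemma tamari_le_antisym:
  assumes "tamari_le S T" "tamari_le T S"
  shows "S = T"
proof -
  have *: "A = B \<or> left_weight B < left_weight A" if "tamari_le A B" for A B
    using that unfolding tamari_le_def
    by (induction rule: rtranclp_induct) (auto dest: tamari_step_left_weight)
  show ?thesis using *[OF assms(1)] *[OF assms(2)] by auto
qed

lemma tamari_le_degree: "tamari_le S T \<Longrightarrow> degree S = degree T"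
  unfolding tamari_le_def
  by (induction rule: rtranclp_induct) (auto dest: tamari_step_degree)


lemma bij_tamari_incidence_transpose:
  "bij_betw (mat_apply (trees n) (\<lambda>v w. incidence tamari_le w v))
    (free_on (trees n)) (free_on (trees n) :: (pbtree \<Rightarrow>\<^sub>0 'k::field) set)"
  by (rule bij_incidence_transpose)
    (auto intro: finite_trees tamari_le_refl tamari_le_antisym tamari_le_trans)


section \<open>The free dendriform algebra on one generator\<close>

text \<open>\<open>tprec S T\<close> and \<open>tsucc S T\<close> are only meaningful if \<open>S\<close> and \<open>T\<close> are not both the
  trivial tree; the values \<open>S \<prec> | = S\<close>, \<open>| \<succ> T = T\<close> and \<open>| \<prec> T = S \<succ> | = 0\<close> are the usual
  conventions for the unit of \<open>*\<close>.\<close>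

function tprec tsucc tstar :: "pbtree \<Rightarrow> pbtree \<Rightarrow> (pbtree \<Rightarrow>\<^sub>0 'k::field)" where
  "tprec (Nd S1 S2) T = lin (\<lambda>U. basis (Nd S1 U)) (tstar S2 T)"
| "tprec Lf T = 0"
| "tsucc S (Nd T1 T2) = lin (\<lambda>U. basis (Nd U T2)) (tstar S T1)"
| "tsucc S Lf = 0"
| "tstar Lf T = basis T"
| "tstar (Nd S1 S2) Lf = basis (Nd S1 S2)"
| "tstar (Nd S1 S2) (Nd T1 T2) =
     tprec (Nd S1 S2) (Nd T1 T2) + tsucc (Nd S1 S2) (Nd T1 T2)"
  by pat_completeness auto
termination
  by (relation "measure (\<lambda>x. case x of
      Inl (S, T) \<Rightarrow> 2 * (degree S + degree T)
    | Inr (Inl (S, T)) \<Rightarrow> 2 * (degree S + degree T)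
    | Inr (Inr (S, T)) \<Rightarrow> 2 * (degree S + degree T) + 1)") auto

definition bilin :: "('a \<Rightarrow> 'b \<Rightarrow> ('c \<Rightarrow>\<^sub>0 'k)) \<Rightarrow> ('a \<Rightarrow>\<^sub>0 'k) \<Rightarrow> ('b \<Rightarrow>\<^sub>0 'k) \<Rightarrow> ('c \<Rightarrow>\<^sub>0 'k::field)"
  where "bilin h a b = lin (\<lambda>S. lin (\<lambda>T. h S T) b) a"

definition prec (infixl "\<prec>\<^sub>D" 70) where "prec = bilin tprec"
definition succ (infixl "\<succ>\<^sub>D" 70) where "succ = bilin tsucc"
definition star (infixl "\<star>\<^sub>D" 70) where "star = bilin tstar"

lemma bilin_basis [simp]: "bilin h (basis S) (basis T) = h S T"
  by (simp add: bilin_def)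

lemma bilin_basis_left: "bilin h (basis S) b = lin (h S) b"
  by (simp add: bilin_def)

lemma bilin_basis_right: "bilin h a (basis T) = lin (\<lambda>S. h S T) a"
  by (simp add: bilin_def)

lemma bilin_lin_left: "bilin h (lin f a) b = lin (\<lambda>x. bilin h (f x) b) a"
  by (simp add: bilin_def lin_lin)

lemma bilin_lin_right: "bilin h a (lin g b) = lin (\<lambda>y. bilin h a (g y)) b"
  unfolding bilin_def lin_lin by (rule lin_swap)

lemma bilin_add_left: "bilin h (a + b) c = bilin h a c + bilin h b c"
  by (simp add: bilin_def lin_add)

lemma bilin_add_right: "bilin h a (b + c) = bilin h a b + bilin h a c"
  by (simp add: bilin_def lin_add lin_add_fun)

lemma lin_bilin: "lin f (bilin h a b) = bilin (\<lambda>S T. lin f (h S T)) a b"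
  by (simp add: bilin_def lin_lin)

lemma bilin_cong:
  "a \<in> free_on P \<Longrightarrow> b \<in> free_on Q \<Longrightarrow> (\<And>S T. S \<in> P \<Longrightarrow> T \<in> Q \<Longrightarrow> h S T = h' S T)
    \<Longrightarrow> bilin h a b = bilin h' a b"
  unfolding bilin_def by (intro lin_cong) (auto simp: free_on_def)

lemma bilin_add_fun: "bilin (\<lambda>S T. h S T + h' S T) a b = bilin h a b + bilin h' a b"
  by (simp add: bilin_def lin_add_fun)

lemma free_on_bilin:
  "a \<in> free_on P \<Longrightarrow> b \<in> free_on Q \<Longrightarrow> (\<And>S T. S \<in> P \<Longrightarrow> T \<in> Q \<Longrightarrow> h S T \<in> free_on R)
    \<Longrightarrow> bilin h a b \<in> free_on R"
  unfolding bilin_def by (intro free_on_lin[of a P] free_on_lin[of b Q])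

text \<open>Equality of two trilinear expressions can be checked on trees.\<close>

lemma bilin_ext3:
  assumes "\<And>A B C. bilin f (g A B) (basis C) = bilin f' (basis A) (g' B C)"
  shows "bilin f (bilin g a b) c = bilin f' a (bilin g' b c)"
proof -
  have "bilin f (bilin g a b) c = lin (\<lambda>A. lin (\<lambda>B. bilin f (g A B) c) b) a"
    by (simp add: bilin_def[of g] bilin_lin_left)
  also have "\<dots> = lin (\<lambda>A. lin (\<lambda>B. lin (\<lambda>C. bilin f (g A B) (basis C)) c) b) a"
    by (subst bilin_lin_right[symmetric]) simp
  also have "\<dots> = lin (\<lambda>A. lin (\<lambda>B. lin (\<lambda>C. bilin f' (basis A) (g' B C)) c) b) a"
    by (simp add: assms)
  also have "\<dots> = bilin f' a (bilin g' b c)"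
    by (simp add: bilin_def[of g'] bilin_lin_right[symmetric] bilin_lin_left[symmetric])
  finally show ?thesis .
qed

lemma lin_zero_fun [simp]: "lin (\<lambda>x. 0) a = 0"
  by (simp add: lin_def)

lemma tprec_Lf_fun: "tprec Lf = (\<lambda>T. 0)"
  by (rule ext) simp

lemma tstar_Lf_fun: "tstar Lf = basis"
  by (rule ext) simp

lemma tstar_Lf_right [simp]: "tstar S Lf = basis S"
  by (cases S) auto

lemma tprec_Lf_right: "S \<noteq> Lf \<Longrightarrow> tprec S Lf = basis S"
  by (cases S) auto

lemma tsucc_Lf_left: "T \<noteq> Lf \<Longrightarrow> tsucc Lf T = basis T"
  by (cases T) auto

lemma tstar_eq: "S \<noteq> Lf \<or> T \<noteq> Lf \<Longrightarrow> tstar S T = tprec S T + tsucc S T"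
  by (cases S; cases T) auto

lemma graded:
  "(tprec S T :: _ \<Rightarrow>\<^sub>0 'k::field) \<in> free_on (trees (degree S + degree T))"
  "(tsucc S T :: _ \<Rightarrow>\<^sub>0 'k) \<in> free_on (trees (degree S + degree T))"
  "(tstar S T :: _ \<Rightarrow>\<^sub>0 'k) \<in> free_on (trees (degree S + degree T))"
proof (induction S T and S T and S T rule: tprec_tsucc_tstar.induct)
  case (1 S1 S2 T)
  show ?case unfolding tprec.simps
    by (rule free_on_lin[OF 1]) (auto intro!: free_on_basis simp: trees_def)
next
  case (3 S T1 T2)
  show ?case unfolding tsucc.simps
    by (rule free_on_lin[OF 3]) (auto intro!: free_on_basis simp: trees_def)
next
  case (7 S1 S2 T1 T2)
  show ?case unfolding tstar.simps by (rule free_on_add[OF 7])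
qed (auto intro!: free_on_basis free_on_zero simp: trees_def)

lemma tstar_assoc:
  "star (tstar A B) (basis C) = star (basis A) (tstar B C :: pbtree \<Rightarrow>\<^sub>0 'k::field)"
  and tprec_tprec: "prec (tprec A B) (basis C) = prec (basis A) (tstar B C :: _ \<Rightarrow>\<^sub>0 'k)"
  and tsucc_tsucc: "succ (tstar A B) (basis C) = succ (basis A) (tsucc B C :: _ \<Rightarrow>\<^sub>0 'k)"
  and tsucc_tprec: "prec (tsucc A B) (basis C) = succ (basis A) (tprec B C :: _ \<Rightarrow>\<^sub>0 'k)"
proof -
  have mid: "prec (tsucc A B) (basis C) = succ (basis A) (tprec B C :: _ \<Rightarrow>\<^sub>0 'k)" for A B C
  proof (cases B)
    case (Nd B1 B2)
    show ?thesis
      unfolding Nd prec_def succ_def bilin_basis_left bilin_basis_right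
        tprec.simps tsucc.simps lin_lin lin_basis by (rule lin_swap)
  qed (simp add: prec_def succ_def bilin_def lin_def)
  have pp: "prec (tprec A B) (basis C) = prec (basis A) (tstar B C :: _ \<Rightarrow>\<^sub>0 'k)"
    if "\<And>A1 A2. A = Nd A1 A2 \<Longrightarrow>
      star (tstar A2 B) (basis C) = star (basis A2) (tstar B C :: _ \<Rightarrow>\<^sub>0 'k)" for A B C
  proof (cases A)
    case (Nd A1 A2)
    have "prec (tprec A B) (basis C)
        = lin (\<lambda>V. basis (Nd A1 V)) (star (tstar A2 B) (basis C) :: _ \<Rightarrow>\<^sub>0 'k)"
      by (simp add: Nd prec_def star_def bilin_basis_right lin_lin)
    also have "\<dots> = lin (\<lambda>V. basis (Nd A1 V)) (star (basis A2) (tstar B C))"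
      by (simp add: that[OF Nd])
    also have "\<dots> = prec (basis A) (tstar B C)"
      unfolding Nd prec_def star_def bilin_basis_left lin_lin by (rule lin_cong) simp
    finally show ?thesis .
  qed (simp add: prec_def bilin_basis_left tprec_Lf_fun, simp add: bilin_def)
  have ss: "succ (tstar A B) (basis C) = succ (basis A) (tsucc B C :: _ \<Rightarrow>\<^sub>0 'k)"
    if "\<And>C1 C2. C = Nd C1 C2 \<Longrightarrow>
      star (tstar A B) (basis C1) = star (basis A) (tstar B C1 :: _ \<Rightarrow>\<^sub>0 'k)" for A B C
  proof (cases C)
    case (Nd C1 C2)
    have "succ (tstar A B) (basis C)
        = lin (\<lambda>V. basis (Nd V C2)) (star (tstar A B) (basis C1) :: _ \<Rightarrow>\<^sub>0 'k)"
      by (simp add: Nd succ_def star_def bilin_basis_right lin_lin)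
    also have "\<dots> = lin (\<lambda>V. basis (Nd V C2)) (star (basis A) (tstar B C1))"
      by (simp add: that[OF Nd])
    also have "\<dots> = succ (basis A) (tsucc B C)"
      by (simp add: Nd succ_def star_def bilin_basis_left lin_lin)
    finally show ?thesis .
  qed (simp add: succ_def bilin_basis_right, simp add: bilin_basis_left)
  have split: "star a b = prec a b + succ a b"
    if "a \<in> free_on P" "b \<in> free_on Q" "Lf \<notin> P \<or> Lf \<notin> Q" for a b :: "pbtree \<Rightarrow>\<^sub>0 'k" and P Q
    unfolding star_def prec_def succ_def bilin_add_fun[symmetric]
    using that by (intro bilin_cong[OF that(1,2)] tstar_eq) auto
  have assoc: "star (tstar A B) (basis C) = star (basis A) (tstar B C :: _ \<Rightarrow>\<^sub>0 'k)" for A B C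
  proof (induction "degree A + degree B + degree C" arbitrary: A B C rule: less_induct)
    case less
    show ?case
    proof (cases "A = Lf \<or> B = Lf \<or> C = Lf")
      case True
      have "star (basis Lf) b = b" for b :: "pbtree \<Rightarrow>\<^sub>0 'k"
        by (simp add: star_def bilin_basis_left tstar_Lf_fun)
      moreover have "star a (basis Lf) = a" for a :: "pbtree \<Rightarrow>\<^sub>0 'k"
        by (simp add: star_def bilin_basis_right)
      moreover have "star (basis S) (basis T) = (tstar S T :: _ \<Rightarrow>\<^sub>0 'k)" for S T
        by (simp add: star_def)
      ultimately show ?thesis using True
        by (elim disjE) (simp_all only: tstar.simps tstar_Lf_right)
    next
      case False
      then have "star (tstar A B) (basis C) = prec (tstar A B) (basis C)
          + (succ (tstar A B) (basis C) :: _ \<Rightarrow>\<^sub>0 'k)"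
        by (intro split[of _ UNIV _ "- {Lf}"] free_on_basis) (auto simp: free_on_def)
      also have "\<dots> = prec (tprec A B) (basis C) + prec (tsucc A B) (basis C)
          + succ (tstar A B) (basis C)"
        using False by (simp only: tstar_eq[of A B] prec_def bilin_add_left de_Morgan_disj simp_thms)
      also have "prec (tprec A B) (basis C) = prec (basis A) (tstar B C :: _ \<Rightarrow>\<^sub>0 'k)"
        by (rule pp, rule less.hyps) simp
      also have "succ (tstar A B) (basis C) = succ (basis A) (tsucc B C :: _ \<Rightarrow>\<^sub>0 'k)"
        by (rule ss, rule less.hyps) simp
      also have "prec (tsucc A B) (basis C) = succ (basis A) (tprec B C :: _ \<Rightarrow>\<^sub>0 'k)"
        by (rule mid)
      also have "prec (basis A) (tstar B C) + succ (basis A) (tprec B C)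
            + succ (basis A) (tsucc B C)
          = prec (basis A) (tstar B C) + (succ (basis A) (tstar B C) :: _ \<Rightarrow>\<^sub>0 'k)"
        using False
        by (simp only: tstar_eq[of B C] succ_def bilin_add_right add.assoc de_Morgan_disj simp_thms)
      also have "\<dots> = star (basis A) (tstar B C)"
        using False by (intro split[symmetric, of _ "- {Lf}" _ UNIV] free_on_basis) (auto simp: free_on_def)
      finally show ?thesis .
    qed
  qed
  show "star (tstar A B) (basis C) = star (basis A) (tstar B C :: _ \<Rightarrow>\<^sub>0 'k)" by (rule assoc)
  show "prec (tprec A B) (basis C) = prec (basis A) (tstar B C :: _ \<Rightarrow>\<^sub>0 'k)"
    by (rule pp, rule assoc)
  show "succ (tstar A B) (basis C) = succ (basis A) (tsucc B C :: _ \<Rightarrow>\<^sub>0 'k)"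
    by (rule ss, rule assoc)
  show "prec (tsucc A B) (basis C) = succ (basis A) (tprec B C :: _ \<Rightarrow>\<^sub>0 'k)" by (rule mid)
qed

lemma prec_prec: "(a \<prec>\<^sub>D b) \<prec>\<^sub>D c = a \<prec>\<^sub>D (b \<star>\<^sub>D c)"
  unfolding prec_def star_def by (rule bilin_ext3) (fold prec_def star_def, rule tprec_tprec)

lemma succ_prec: "(a \<succ>\<^sub>D b) \<prec>\<^sub>D c = a \<succ>\<^sub>D (b \<prec>\<^sub>D c)"
  unfolding prec_def succ_def by (rule bilin_ext3) (fold prec_def succ_def, rule tsucc_tprec)

lemma succ_succ: "(a \<star>\<^sub>D b) \<succ>\<^sub>D c = a \<succ>\<^sub>D (b \<succ>\<^sub>D c)"
  unfolding succ_def star_def by (rule bilin_ext3) (fold succ_def star_def, rule tsucc_tsucc)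

lemma star_eq:
  assumes "a \<in> free_on (- {Lf})" "b \<in> free_on (- {Lf})"
  shows "a \<star>\<^sub>D b = a \<prec>\<^sub>D b + a \<succ>\<^sub>D b"
  unfolding star_def prec_def succ_def bilin_add_fun[symmetric]
  by (intro bilin_cong[OF assms] tstar_eq) auto

lemma dendriform_relations:
  assumes "x \<in> free_on (- {Lf})" "y \<in> free_on (- {Lf})" "z \<in> free_on (- {Lf})"
  shows "(x \<prec>\<^sub>D y) \<prec>\<^sub>D z = x \<prec>\<^sub>D (y \<prec>\<^sub>D z) + x \<prec>\<^sub>D (y \<succ>\<^sub>D z)"
    and "x \<succ>\<^sub>D (y \<prec>\<^sub>D z) = (x \<succ>\<^sub>D y) \<prec>\<^sub>D z"
    and "x \<succ>\<^sub>D (y \<succ>\<^sub>D z) = (x \<succ>\<^sub>D y) \<succ>\<^sub>D z + (x \<prec>\<^sub>D y) \<succ>\<^sub>D z"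
proof -
  show "(x \<prec>\<^sub>D y) \<prec>\<^sub>D z = x \<prec>\<^sub>D (y \<prec>\<^sub>D z) + x \<prec>\<^sub>D (y \<succ>\<^sub>D z)"
    by (simp add: prec_prec star_eq[OF assms(2,3)]) (simp add: prec_def bilin_add_right)
  show "x \<succ>\<^sub>D (y \<prec>\<^sub>D z) = (x \<succ>\<^sub>D y) \<prec>\<^sub>D z"
    by (simp add: succ_prec)
  show "x \<succ>\<^sub>D (y \<succ>\<^sub>D z) = (x \<succ>\<^sub>D y) \<succ>\<^sub>D z + (x \<prec>\<^sub>D y) \<succ>\<^sub>D z"
    by (simp add: succ_succ[symmetric] star_eq[OF assms(1,2)])
      (simp add: succ_def bilin_add_left add.commute)
qed


section \<open>The dendriform operad\<close>

abbreviation kY :: "nat \<Rightarrow> (pbtree \<Rightarrow>\<^sub>0 'k::field) set" where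
  "kY n \<equiv> free_on (trees n)"

text \<open>Under the identification \<open>\<mu> \<mapsto> \<mu>(Y, \<dots>, Y)\<close>, a tree \<open>T\<close> of degree \<open>n\<close> is an
  \<open>n\<close>-ary operation on dendriform algebras. As \<open>Nd S T = (S \<succ> Y) \<prec> T\<close> in the free dendriform
  algebra on \<open>Y\<close>, where \<open>| \<succ> Y = Y\<close> and \<open>x \<prec> | = x\<close>, this operation is obtained
  recursively; \<open>act T xs\<close> is its value on the list \<open>xs\<close> of \<open>n\<close> elements
  of the free dendriform algebra. (The value of \<open>act\<close> at the trivial tree is the unit, which only
  serves this recursion.) The lemmas \<open>pcomp_monomial\<close>, \<open>at_Y_surj\<close> and
  \<open>pcomp_bilin\<close> below confirm that \<open>pcomp\<close> is the composition of the operad generated by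
  the two products.\<close>

primrec act :: "pbtree \<Rightarrow> (pbtree \<Rightarrow>\<^sub>0 'k) list \<Rightarrow> (pbtree \<Rightarrow>\<^sub>0 'k::field)" where
  "act Lf xs = basis Lf"
| "act (Nd S T) xs =
     (act S (take (degree S) xs) \<succ>\<^sub>D (xs ! degree S)) \<prec>\<^sub>D act T (drop (degree S + 1) xs)"

text \<open>\<open>\<mu> \<circ>\<^sub>i \<nu>\<close>, that is \<open>\<mu>(Y, \<dots>, Y, \<nu>, Y, \<dots>, Y)\<close> with \<open>\<nu>\<close> as the \<open>i\<close>-th argument, counted
  from 1.\<close>

definition pcomp :: "(pbtree \<Rightarrow>\<^sub>0 'k) \<Rightarrow> nat \<Rightarrow> (pbtree \<Rightarrow>\<^sub>0 'k) \<Rightarrow> (pbtree \<Rightarrow>\<^sub>0 'k::field)" where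
  "pcomp \<mu> i \<nu> = lin (\<lambda>T. act T ((replicate (degree T) (basis Ytree))[i - 1 := \<nu>])) \<mu>"

abbreviation kYplus :: "(pbtree \<Rightarrow>\<^sub>0 'k::field) set" where
  "kYplus \<equiv> free_on (- {Lf})"

lemma act_Ytree: "act T (replicate (degree T) (basis Ytree)) = basis T"
proof (induction T)
  case (Nd S T)
  let ?r = "\<lambda>n. replicate n (basis Ytree :: _ \<Rightarrow>\<^sub>0 'a)"
  have "?r (degree (Nd S T)) = ?r (degree S) @ basis Ytree # ?r (degree T)"
    by (simp add: replicate_add[symmetric] replicate_app_Cons_same)
  then have "act (Nd S T) (?r (degree (Nd S T)))
      = (act S (?r (degree S)) \<succ>\<^sub>D basis Ytree) \<prec>\<^sub>D act T (?r (degree T))"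
    by (simp add: nth_append del: replicate_Suc degree.simps)
  then show ?case by (simp only: Nd) (simp add: prec_def succ_def Ytree_def)
qed simp

lemma prec_in_kYplus: "a \<in> kYplus \<Longrightarrow> a \<prec>\<^sub>D b \<in> kYplus"
  unfolding prec_def
proof (rule free_on_bilin[where Q = UNIV])
  fix S T :: pbtree assume "S \<in> - {Lf}"
  then show "(tprec S T :: _ \<Rightarrow>\<^sub>0 'a) \<in> kYplus"
    by (cases S) (auto intro!: free_on_lin[where P = UNIV] free_on_basis simp: free_on_def[of UNIV])
qed (auto simp: free_on_def)

lemma succ_in_kYplus: "b \<in> kYplus \<Longrightarrow> a \<succ>\<^sub>D b \<in> kYplus"
  unfolding succ_def
proof (rule free_on_bilin[where P = UNIV])
  fix S T :: pbtree assume "T \<in> - {Lf}"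
  then show "(tsucc S T :: _ \<Rightarrow>\<^sub>0 'a) \<in> kYplus"
    by (cases T) (auto intro!: free_on_lin[where P = UNIV] free_on_basis simp: free_on_def[of UNIV])
qed (auto simp: free_on_def)

lemma act_in_kYplus:
  assumes "T \<noteq> Lf" "length xs = degree T" "set xs \<subseteq> kYplus"
  shows "act T xs \<in> kYplus"
  using assms by (cases T) (auto intro!: prec_in_kYplus succ_in_kYplus)

text \<open>\<open>T \<mapsto> act T\<close> turns the products of trees into the products of operations.\<close>

lemma act_products:
  fixes xs ys :: "(pbtree \<Rightarrow>\<^sub>0 'k::field) list"
  assumes "length xs = degree S" "length ys = degree T" "set xs \<subseteq> kYplus" "set ys \<subseteq> kYplus"
  shows "lin (\<lambda>U. act U (xs @ ys)) (tprec S T) = act S xs \<prec>\<^sub>D act T ys"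
    and "lin (\<lambda>U. act U (xs @ ys)) (tsucc S T) = act S xs \<succ>\<^sub>D act T ys"
    and "lin (\<lambda>U. act U (xs @ ys)) (tstar S T) = act S xs \<star>\<^sub>D act T ys"
  using assms
proof (induction S T and S T and S T arbitrary: xs ys and xs ys and xs ys
    rule: tprec_tsucc_tstar.induct)
  case (1 S1 S2 T)
  let ?p = "act S1 (take (degree S1) xs) \<succ>\<^sub>D (xs ! degree S1)"
  let ?xs2 = "drop (degree S1 + 1) xs"
  have "lin (\<lambda>U. act U (xs @ ys)) (tprec (Nd S1 S2) T)
      = lin (\<lambda>U. ?p \<prec>\<^sub>D act U (?xs2 @ ys)) (tstar S2 T)"
    using "1.prems" by (simp add: lin_lin nth_append)
  also have "\<dots> = ?p \<prec>\<^sub>D lin (\<lambda>U. act U (?xs2 @ ys)) (tstar S2 T)"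
    by (simp add: prec_def bilin_lin_right)
  also have "lin (\<lambda>U. act U (?xs2 @ ys)) (tstar S2 T) = act S2 ?xs2 \<star>\<^sub>D act T ys"
    by (rule "1.IH") (use "1.prems" in \<open>auto dest: in_set_dropD\<close>)
  finally show ?case by (simp add: prec_prec)
next
  case (2 T)
  show ?case by (simp add: prec_def bilin_basis_left tprec_Lf_fun)
next
  case (3 S T1 T2)
  let ?ys1 = "take (degree T1) ys" and ?y = "ys ! degree T1"
  let ?q = "act T2 (drop (degree T1 + 1) ys)"
  have "lin (\<lambda>U. act U (xs @ ys)) (tsucc S (Nd T1 T2))
      = lin (\<lambda>U. act (Nd U T2) (xs @ ys)) (tstar S T1)"
    by (simp add: lin_lin)
  also have "\<dots> = lin (\<lambda>U. (act U (xs @ ?ys1) \<succ>\<^sub>D ?y) \<prec>\<^sub>D ?q) (tstar S T1)"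
  proof (rule lin_cong)
    fix U assume "U \<in> Poly_Mapping.keys (tstar S T1 :: _ \<Rightarrow>\<^sub>0 'k)"
    then have "degree U = degree S + degree T1"
      using graded(3)[of S T1, where ?'k = 'k] by (auto simp: free_on_def trees_def)
    then show "act (Nd U T2) (xs @ ys) = (act U (xs @ ?ys1) \<succ>\<^sub>D ?y) \<prec>\<^sub>D ?q"
      using "3.prems" by (simp add: nth_append)
  qed
  also have "\<dots> = (lin (\<lambda>U. act U (xs @ ?ys1)) (tstar S T1) \<succ>\<^sub>D ?y) \<prec>\<^sub>D ?q"
    by (simp add: prec_def succ_def bilin_lin_left)
  also have "lin (\<lambda>U. act U (xs @ ?ys1)) (tstar S T1) = act S xs \<star>\<^sub>D act T1 ?ys1"
    by (rule "3.IH") (use "3.prems" in \<open>auto dest: in_set_takeD\<close>)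
  finally show ?case by (simp add: succ_succ succ_prec)
next
  case (4 S)
  show ?case by (simp add: succ_def bilin_basis_right)
next
  case (5 T)
  then show ?case by (simp add: star_def bilin_basis_left tstar_Lf_fun)
next
  case (6 S1 S2)
  then show ?case by (simp add: star_def bilin_basis_right del: act.simps(2))
next
  case (7 S1 S2 T1 T2)
  have "act (Nd S1 S2) xs \<in> kYplus" "act (Nd T1 T2) ys \<in> kYplus"
    using "7.prems" by (intro act_in_kYplus; simp)+
  then show ?case
    using 7 by (simp add: lin_add star_eq del: act.simps tprec.simps tsucc.simps)
qed

lemma act_prec_succ:
  fixes a b :: "pbtree \<Rightarrow>\<^sub>0 'k::field"
  assumes "a \<in> kY n" "b \<in> kY m" "length xs = n" "length ys = m" "set xs \<subseteq> kYplus" "set ys \<subseteq> kYplus"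
  shows "lin (\<lambda>U. act U (xs @ ys)) (a \<prec>\<^sub>D b) = lin (\<lambda>S. act S xs) a \<prec>\<^sub>D lin (\<lambda>T. act T ys) b"
    and "lin (\<lambda>U. act U (xs @ ys)) (a \<succ>\<^sub>D b) = lin (\<lambda>S. act S xs) a \<succ>\<^sub>D lin (\<lambda>T. act T ys) b"
proof -
  have "lin (\<lambda>U. act U (xs @ ys)) (a \<prec>\<^sub>D b) = bilin (\<lambda>S T. act S xs \<prec>\<^sub>D act T ys) a b"
    unfolding prec_def lin_bilin
    by (rule bilin_cong[OF assms(1,2)], fold prec_def, rule act_products)
      (use assms in \<open>auto simp: trees_def\<close>)
  then show "lin (\<lambda>U. act U (xs @ ys)) (a \<prec>\<^sub>D b) = lin (\<lambda>S. act S xs) a \<prec>\<^sub>D lin (\<lambda>T. act T ys) b"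
    by (simp only: prec_def bilin_lin_left) (simp add: bilin_lin_right bilin_def[of "\<lambda>S T. bilin tprec (act S xs) (act T ys)"])
  have "lin (\<lambda>U. act U (xs @ ys)) (a \<succ>\<^sub>D b) = bilin (\<lambda>S T. act S xs \<succ>\<^sub>D act T ys) a b"
    unfolding succ_def lin_bilin
    by (rule bilin_cong[OF assms(1,2)], fold succ_def, rule act_products)
      (use assms in \<open>auto simp: trees_def\<close>)
  then show "lin (\<lambda>U. act U (xs @ ys)) (a \<succ>\<^sub>D b) = lin (\<lambda>S. act S xs) a \<succ>\<^sub>D lin (\<lambda>T. act T ys) b"
    by (simp only: succ_def bilin_lin_left) (simp add: bilin_lin_right bilin_def[of "\<lambda>S T. bilin tsucc (act S xs) (act T ys)"])
qed

text \<open>Monomials in the two generators form a basis of the free non-symmetric operad on \<open>\<prec>\<close> and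
  \<open>\<succ>\<close>, with partial composition \<open>graft\<close>; \<open>at_Y\<close> is the identification map
  \<open>\<mu> \<mapsto> \<mu>(Y, \<dots>, Y)\<close>.\<close>

datatype monomial = Ident | Prec monomial monomial | Succ monomial monomial

primrec arity :: "monomial \<Rightarrow> nat" where
  "arity Ident = 1"
| "arity (Prec s t) = arity s + arity t"
| "arity (Succ s t) = arity s + arity t"

primrec eval_monomial :: "monomial \<Rightarrow> (pbtree \<Rightarrow>\<^sub>0 'k) list \<Rightarrow> (pbtree \<Rightarrow>\<^sub>0 'k::field)" where
  "eval_monomial Ident xs = xs ! 0"
| "eval_monomial (Prec s t) xs =
     eval_monomial s (take (arity s) xs) \<prec>\<^sub>D eval_monomial t (drop (arity s) xs)"
| "eval_monomial (Succ s t) xs =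
     eval_monomial s (take (arity s) xs) \<succ>\<^sub>D eval_monomial t (drop (arity s) xs)"

definition at_Y :: "monomial \<Rightarrow> (pbtree \<Rightarrow>\<^sub>0 'k::field)" where
  "at_Y s = eval_monomial s (replicate (arity s) (basis Ytree))"

primrec graft :: "monomial \<Rightarrow> nat \<Rightarrow> monomial \<Rightarrow> monomial" where
  "graft Ident i t = t"
| "graft (Prec s1 s2) i t =
     (if i \<le> arity s1 then Prec (graft s1 i t) s2 else Prec s1 (graft s2 (i - arity s1) t))"
| "graft (Succ s1 s2) i t =
     (if i \<le> arity s1 then Succ (graft s1 i t) s2 else Succ s1 (graft s2 (i - arity s1) t))"

lemma arity_pos: "arity s > 0"
  by (induction s) auto

lemma at_Y_simps:
  "at_Y Ident = basis Ytree"
  "at_Y (Prec s t) = at_Y s \<prec>\<^sub>D at_Y t"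
  "at_Y (Succ s t) = at_Y s \<succ>\<^sub>D at_Y t"
  by (simp_all add: at_Y_def min_def)

lemma at_Y_in_kY: "(at_Y s :: _ \<Rightarrow>\<^sub>0 'k::field) \<in> kY (arity s)"
proof (induction s)
  case Ident
  show ?case by (simp add: at_Y_simps Ytree_def trees_def free_on_basis)
next
  case (Prec s t)
  then show ?case unfolding at_Y_simps prec_def arity.simps
  proof (rule free_on_bilin)
    fix S T assume "S \<in> trees (arity s)" "T \<in> trees (arity t)"
    then show "(tprec S T :: _ \<Rightarrow>\<^sub>0 'k) \<in> kY (arity s + arity t)"
      using graded(1)[of S T, where ?'k = 'k] by (simp add: trees_def)
  qed
next
  case (Succ s t)
  then show ?case unfolding at_Y_simps succ_def arity.simps
  proof (rule free_on_bilin)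
    fix S T assume "S \<in> trees (arity s)" "T \<in> trees (arity t)"
    then show "(tsucc S T :: _ \<Rightarrow>\<^sub>0 'k) \<in> kY (arity s + arity t)"
      using graded(2)[of S T, where ?'k = 'k] by (simp add: trees_def)
  qed
qed

text \<open>A monomial acts on the free dendriform algebra as its image under \<open>at_Y\<close> does.\<close>

lemma eval_monomial_eq_act:
  assumes "length xs = arity s" "set xs \<subseteq> kYplus"
  shows "eval_monomial s xs = lin (\<lambda>T. act T xs) (at_Y s)"
  using assms
proof (induction s arbitrary: xs)
  case Ident
  then obtain x where x: "xs = [x]" "x \<in> kYplus" by (cases xs) auto
  have "lin (tsucc Lf) x = lin basis x"
    using x(2) by (intro lin_cong tsucc_Lf_left) (auto simp: free_on_def)
  moreover have "lin (\<lambda>S. tprec S Lf) x = lin basis x"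
    using x(2) by (intro lin_cong tprec_Lf_right) (auto simp: free_on_def)
  ultimately show ?case
    by (simp add: x(1) at_Y_simps Ytree_def prec_def succ_def bilin_basis_left bilin_basis_right
        del: tprec.simps tsucc.simps)
next
  case (Prec s t)
  have "lin (\<lambda>T. act T (take (arity s) xs @ drop (arity s) xs)) (at_Y s \<prec>\<^sub>D at_Y t)
      = lin (\<lambda>T. act T (take (arity s) xs)) (at_Y s) \<prec>\<^sub>D lin (\<lambda>T. act T (drop (arity s) xs)) (at_Y t)"
    by (rule act_prec_succ[OF at_Y_in_kY at_Y_in_kY])
      (use Prec.prems in \<open>auto dest: in_set_takeD in_set_dropD\<close>)
  moreover have "eval_monomial s (take (arity s) xs) = lin (\<lambda>T. act T (take (arity s) xs)) (at_Y s)"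
    by (rule Prec.IH) (use Prec.prems in \<open>auto dest: in_set_takeD\<close>)
  moreover have "eval_monomial t (drop (arity s) xs) = lin (\<lambda>T. act T (drop (arity s) xs)) (at_Y t)"
    by (rule Prec.IH) (use Prec.prems in \<open>auto dest: in_set_dropD\<close>)
  ultimately show ?case by (simp add: at_Y_simps)
next
  case (Succ s t)
  have "lin (\<lambda>T. act T (take (arity s) xs @ drop (arity s) xs)) (at_Y s \<succ>\<^sub>D at_Y t)
      = lin (\<lambda>T. act T (take (arity s) xs)) (at_Y s) \<succ>\<^sub>D lin (\<lambda>T. act T (drop (arity s) xs)) (at_Y t)"
    by (rule act_prec_succ[OF at_Y_in_kY at_Y_in_kY])
      (use Succ.prems in \<open>auto dest: in_set_takeD in_set_dropD\<close>)
  moreover have "eval_monomial s (take (arity s) xs) = lin (\<lambda>T. act T (take (arity s) xs)) (at_Y s)"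
    by (rule Succ.IH) (use Succ.prems in \<open>auto dest: in_set_takeD\<close>)
  moreover have "eval_monomial t (drop (arity s) xs) = lin (\<lambda>T. act T (drop (arity s) xs)) (at_Y t)"
    by (rule Succ.IH) (use Succ.prems in \<open>auto dest: in_set_dropD\<close>)
  ultimately show ?case by (simp add: at_Y_simps)
qed

lemma replicate_update:
  "1 \<le> i \<Longrightarrow> (replicate (m + n) y)[i - 1 := x] =
     (if i \<le> m then (replicate m y)[i - 1 := x] @ replicate n y
      else replicate m y @ (replicate n y)[i - m - 1 := x])"
  by (auto simp: replicate_add list_update_append)

lemma at_Y_graft:
  assumes "1 \<le> i" "i \<le> arity s"
  shows "at_Y (graft s i t) = eval_monomial s ((replicate (arity s) (basis Ytree))[i - 1 := at_Y t])"
  using assms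
proof (induction s arbitrary: i)
  case Ident
  then show ?case by simp
next
  case (Prec s1 s2)
  have "i - arity s1 \<ge> 1" "i - arity s1 \<le> arity s2" if "\<not> i \<le> arity s1"
    using that Prec.prems by auto
  with Prec show ?case
    by (simp only: arity.simps eval_monomial.simps replicate_update graft.simps)
      (simp add: at_Y_simps at_Y_def[of s1] at_Y_def[of s2])
next
  case (Succ s1 s2)
  have "i - arity s1 \<ge> 1" "i - arity s1 \<le> arity s2" if "\<not> i \<le> arity s1"
    using that Succ.prems by auto
  with Succ show ?case
    by (simp only: arity.simps eval_monomial.simps replicate_update graft.simps)
      (simp add: at_Y_simps at_Y_def[of s1] at_Y_def[of s2])
qed

lemma pcomp_monomial:
  assumes "1 \<le> i" "i \<le> arity s"
  shows "pcomp (at_Y s) i (at_Y t) = at_Y (graft s i t)"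
proof -
  let ?xs = "(replicate (arity s) (basis Ytree))[i - 1 := at_Y t]"
  have "pcomp (at_Y s) i (at_Y t) = lin (\<lambda>T. act T ?xs) (at_Y s)"
    unfolding pcomp_def
    by (rule lin_cong) (use at_Y_in_kY[of s] in \<open>auto simp: free_on_def trees_def\<close>)
  also have "\<dots> = eval_monomial s ?xs"
  proof (rule eval_monomial_eq_act[symmetric])
    have "at_Y t \<in> kYplus" "basis Ytree \<in> kYplus"
      using at_Y_in_kY[of t] arity_pos[of t] by (auto simp: free_on_def trees_def Ytree_def basis_def)
    then show "set ?xs \<subseteq> kYplus"
      using set_update_subset_insert[of "replicate (arity s) (basis Ytree)" "i - 1" "at_Y t"] by auto
  qed simp
  finally show ?thesis by (simp only: at_Y_graft[OF assms])
qed

lemma at_Y_surj: "T \<noteq> Lf \<Longrightarrow> \<exists>s. arity s = degree T \<and> at_Y s = basis T"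
proof (induction T)
  case (Nd S T)
  have 1: "\<exists>u. arity u = degree S + 1 \<and> at_Y u = (basis (Nd S Lf) :: _ \<Rightarrow>\<^sub>0 'a)"
  proof (cases "S = Lf")
    case True
    then show ?thesis by (intro exI[of _ Ident]) (simp add: at_Y_simps Ytree_def)
  next
    case False
    with Nd obtain s where "arity s = degree S" "at_Y s = (basis S :: _ \<Rightarrow>\<^sub>0 'a)" by blast
    then show ?thesis
      by (intro exI[of _ "Succ s Ident"]) (simp add: at_Y_simps Ytree_def succ_def)
  qed
  then obtain u where u: "arity u = degree S + 1" "at_Y u = (basis (Nd S Lf) :: _ \<Rightarrow>\<^sub>0 'a)"
    by blast
  show ?case
  proof (cases "T = Lf")
    case True
    then show ?thesis using u by (intro exI[of _ u]) simp
  next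
    case False
    with Nd obtain t where "arity t = degree T" "at_Y t = (basis T :: _ \<Rightarrow>\<^sub>0 'a)" by blast
    then show ?thesis using u
      by (intro exI[of _ "Prec u t"]) (simp add: at_Y_simps prec_def)
  qed
qed simp

lemma act_update_lin:
  "j < degree T \<Longrightarrow> length xs = degree T \<Longrightarrow>
    act T (xs[j := b]) = lin (\<lambda>U. act T (xs[j := basis U])) b"
proof (induction T arbitrary: xs j)
  case (Nd S T)
  consider "j < degree S" | "j = degree S" | "j > degree S" by linarith
  then show ?case
  proof cases
    case 1
    then have "act S ((take (degree S) xs)[j := b])
        = lin (\<lambda>U. act S ((take (degree S) xs)[j := basis U])) b"
      using Nd.prems by (intro Nd.IH(1)) auto
    with 1 show ?thesis
      by (simp add: take_update_swap drop_update_cancel prec_def succ_def bilin_lin_left)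
  next
    case 2
    have "(p \<succ>\<^sub>D b) \<prec>\<^sub>D q = lin (\<lambda>U. (p \<succ>\<^sub>D basis U) \<prec>\<^sub>D q) b" for p q :: "pbtree \<Rightarrow>\<^sub>0 'a"
    proof -
      have "p \<succ>\<^sub>D b = lin (\<lambda>U. p \<succ>\<^sub>D basis U) b"
        using bilin_lin_right[of tsucc p basis b] by (simp add: succ_def)
      then show ?thesis by (simp add: prec_def bilin_lin_left)
    qed
    with 2 Nd.prems show ?thesis
      by (simp add: take_update_cancel drop_update_cancel)
  next
    case 3
    then have "act T ((drop (degree S + 1) xs)[j - (degree S + 1) := b])
        = lin (\<lambda>U. act T ((drop (degree S + 1) xs)[j - (degree S + 1) := basis U])) b"
      using Nd.prems by (intro Nd.IH(2)) auto
    with 3 show ?thesis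
      by (simp add: take_update_cancel drop_update_swap prec_def succ_def bilin_lin_right)
  qed
qed simp

lemma pcomp_bilin:
  assumes "\<mu> \<in> kY n" "1 \<le> i" "i \<le> n"
  shows "pcomp \<mu> i \<nu> = bilin (\<lambda>S T. pcomp (basis S) i (basis T)) \<mu> \<nu>"
  unfolding bilin_def pcomp_def lin_basis
  by (intro lin_cong act_update_lin) (use assms in \<open>auto simp: free_on_def trees_def\<close>)


section \<open>Anticyclic structures\<close>

definition linear_endo_on :: "('k \<Rightarrow> 'v \<Rightarrow> 'v) \<Rightarrow> 'v set \<Rightarrow> ('v::ab_group_add \<Rightarrow> 'v) \<Rightarrow> bool" where
  "linear_endo_on scale V f \<longleftrightarrow>
     (\<forall>x\<in>V. f x \<in> V) \<and> (\<forall>x\<in>V. \<forall>y\<in>V. f (x + y) = f x + f y) \<and>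
     (\<forall>c. \<forall>x\<in>V. f (scale c x) = scale c (f x))"

text \<open>The locale lists only the axioms of \<open>\<tau>\<close>, not those of the operad:
  an anticyclic structure \<open>\<tau>\<close> on a non-symmetric operad with components \<open>P n\<close>, \<open>n \<ge> 1\<close>,
  unit \<open>unit\<close> and partial compositions \<open>comp a i b\<close>.\<close>

locale anticyclic_structure =
  fixes scale :: "'k \<Rightarrow> 'v::ab_group_add \<Rightarrow> 'v"
    and P :: "nat \<Rightarrow> 'v set"
    and unit :: 'v
    and comp :: "'v \<Rightarrow> nat \<Rightarrow> 'v \<Rightarrow> 'v"
    and \<tau> :: "nat \<Rightarrow> 'v \<Rightarrow> 'v"
  assumes linear: "n \<ge> 1 \<Longrightarrow> linear_endo_on scale (P n) (\<tau> n)"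
    and periodic: "n \<ge> 1 \<Longrightarrow> a \<in> P n \<Longrightarrow> (\<tau> n ^^ (n + 1)) a = a"
    and unit: "\<tau> 1 unit = - unit"
    and comp_last: "n \<ge> 1 \<Longrightarrow> m \<ge> 1 \<Longrightarrow> a \<in> P n \<Longrightarrow> b \<in> P m \<Longrightarrow>
      \<tau> (n + m - 1) (comp a n b) = - comp (\<tau> m b) 1 (\<tau> n a)"
    and comp_inner: "m \<ge> 1 \<Longrightarrow> a \<in> P n \<Longrightarrow> b \<in> P m \<Longrightarrow> 1 \<le> i \<Longrightarrow> i < n \<Longrightarrow>
      \<tau> (n + m - 1) (comp a i b) = comp (\<tau> n a) (i + 1) b"

end

theory Submission
  imports Defs
begin

text \<open>
  Write \<open>D T\<close> and \<open>U T\<close> for the sums of all trees below and above \<open>T\<close>, so that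
  \<open>\<theta> (U T) = - D T\<close>. From \<open>D (S / T) = D S / D T\<close>, \<open>D (S \ T) = D S * D T\<close> and their mirror
  images \<open>U (S \ T) = U S \ U T\<close>, \<open>U (S / T) = U S * U T\<close> one gets
  \<open>\<theta> (x * y) = - \<theta> x / \<theta> y\<close> and \<open>\<theta> (x \ y) = - \<theta> x * \<theta> y\<close>. By induction on \<open>T\<close> of degree \<open>n\<close>
  these give \<open>\<theta> (D T / Y) = (-1)\<^sup>n\<^sup>+\<^sup>1 Y \ U T\<close>, hence \<open>\<theta>\<^sup>2 (x / Y) = (-1)\<^sup>n Y * x\<close> in degree \<open>n\<close>.
  As a tree with branches \<open>S\<close> and \<open>T\<close> is \<open>(S / Y) \ T\<close>, the map \<open>(-1)\<^sup>n \<theta>\<^sup>2\<close> sends it to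
  \<open>- (Y * S)\<close> over the image of \<open>T\<close>, and the axioms of an anticyclic structure force the same
  recursion on \<open>\<tau>\<close>.
\<close>

section \<open>Multilinear extensions\<close>

lemma lin_uminus: "lin f (- a) = - lin f a"
  using lin_add[of f a "- a"] by (simp add: eq_neg_iff_add_eq_0 add.commute)

lemma smul_minus_one: "smul (- 1) a = - a"
  by (rule poly_mapping_eqI) simp

lemma smul_uminus_left: "smul (- c) a = - smul c a"
  by (rule poly_mapping_eqI) simp

lemma smul_uminus_right: "smul c (- a) = - smul c a"
  by (rule poly_mapping_eqI) simp

lemma bilin_smul_left: "bilin h (smul c a) b = smul c (bilin h a b)"
  by (simp add: bilin_def lin_smul)

lemma bilin_smul_right: "bilin h a (smul c b) = smul c (bilin h a b)"
  by (simp add: bilin_def lin_smul lin_smul_fun)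

lemma bilin_uminus: "bilin h (- a) (- b) = bilin h a b"
  using bilin_smul_left[of h "- 1" a "- b"] bilin_smul_right[of h a "- 1" b]
  by (simp add: smul_minus_one)

lemma bilin_lin_lin:
  "bilin h (lin f a) (lin g b) = bilin (\<lambda>x y. bilin h (f x) (g y)) a b"
  by (simp only: bilin_lin_left bilin_lin_right bilin_def[of "\<lambda>x y. bilin h (f x) (g y)"])
    (rule lin_swap)

section \<open>Grafting as a bilinear product, and its interplay with \<open>*\<close>\<close>

definition over :: "(pbtree \<Rightarrow>\<^sub>0 'k) \<Rightarrow> (pbtree \<Rightarrow>\<^sub>0 'k) \<Rightarrow> (pbtree \<Rightarrow>\<^sub>0 'k::field)"
    (infixl "'/\<^sub>D" 70) where
  "over = bilin (\<lambda>S T. basis (tree_over S T))"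

definition under :: "(pbtree \<Rightarrow>\<^sub>0 'k) \<Rightarrow> (pbtree \<Rightarrow>\<^sub>0 'k) \<Rightarrow> (pbtree \<Rightarrow>\<^sub>0 'k::field)"
    (infixl "\<setminus>\<^sub>D" 70) where
  "under = bilin (\<lambda>S T. basis (tree_under S T))"

abbreviation Y :: "pbtree \<Rightarrow>\<^sub>0 'k::field" where
  "Y \<equiv> basis Ytree"

lemma over_smul_left: "smul c a /\<^sub>D b = smul c (a /\<^sub>D b)"
  by (simp add: over_def bilin_smul_left)

lemma over_Y: "a /\<^sub>D Y = lin (\<lambda>S. basis (Nd S Lf)) a"
  by (simp add: over_def bilin_basis_right Ytree_def)

lemma Y_under: "Y \<setminus>\<^sub>D a = lin (\<lambda>S. basis (Nd Lf S)) a"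
  by (simp add: under_def bilin_basis_left Ytree_def)

lemma over_Lf_left: "basis Lf /\<^sub>D a = a"
proof -
  have "tree_over Lf T = T" for T by (induction T) auto
  then show ?thesis by (simp add: over_def bilin_basis_left)
qed

lemma under_Lf_right: "a \<setminus>\<^sub>D basis Lf = a"
proof -
  have "tree_under T Lf = T" for T by (induction T) auto
  then show ?thesis by (simp add: under_def bilin_basis_right)
qed

lemma over_Lf_right: "a /\<^sub>D basis Lf = a"
  by (simp add: over_def bilin_basis_right)

lemma star_Lf_left: "basis Lf \<star>\<^sub>D a = a"
  by (simp add: star_def bilin_basis_left tstar_Lf_fun)

lemma star_Lf_right: "a \<star>\<^sub>D basis Lf = a"
  by (simp add: star_def bilin_basis_right)

lemma star_assoc: "(a \<star>\<^sub>D b) \<star>\<^sub>D c = a \<star>\<^sub>D (b \<star>\<^sub>D c)"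
  unfolding star_def by (rule bilin_ext3) (fold star_def, rule tstar_assoc)

text \<open>If \<open>B\<close> is nontrivial, the leftmost leaf of every tree in
  \<open>tstar B C\<close> is that of \<open>B\<close>, so grafting there commutes with the product.
  For \<open>B = Lf\<close> the left-hand side would be \<open>tstar A C\<close> instead.\<close>

lemma tstar_tree_over:
  "B \<noteq> Lf \<Longrightarrow> tstar (tree_over A B) C = lin (\<lambda>U. basis (tree_over A U)) (tstar B C)"
proof (induction C)
  case (Nd C1 C2)
  then obtain B1 B2 where B: "B = Nd B1 B2" by (cases B) auto
  with Nd show ?case
    by (simp add: lin_lin lin_add del: tstar.simps(2))
qed simp

lemma over_star: "(a /\<^sub>D b) /\<^sub>D Y \<star>\<^sub>D c = a /\<^sub>D ((b /\<^sub>D Y) \<star>\<^sub>D c)"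
proof -
  have "bilin tstar (bilin (\<lambda>A B. basis (Nd (tree_over A B) Lf)) a b) c
      = bilin (\<lambda>S T. basis (tree_over S T)) a (bilin (\<lambda>B. tstar (Nd B Lf)) b c)"
  proof (rule bilin_ext3)
    fix A B C
    show "bilin tstar (basis (Nd (tree_over A B) Lf)) (basis C)
        = bilin (\<lambda>S T. basis (tree_over S T)) (basis A) (tstar (Nd B Lf) C :: _ \<Rightarrow>\<^sub>0 'a)"
      using tstar_tree_over[of "Nd B Lf" A C] by (simp add: bilin_basis_left)
  qed
  then show ?thesis
    unfolding over_Y by (simp add: over_def star_def lin_bilin bilin_lin_left)
      (simp add: bilin_def)
qed

text \<open>The summands are the \<open>tprec\<close> and \<open>tsucc\<close> parts of the product;
  the trivial right branch of the left factor turns the former into \<open>under\<close>. In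
  \<open>theta_down_over_Y\<close> this trades \<open>(x * b) / Y\<close> for terms in
  \<open>b / Y\<close>.\<close>

lemma over_Y_star_over_Y:
  "(a /\<^sub>D Y) \<star>\<^sub>D (b /\<^sub>D Y) = (a /\<^sub>D Y) \<setminus>\<^sub>D (b /\<^sub>D Y) + ((a /\<^sub>D Y) \<star>\<^sub>D b) /\<^sub>D Y"
proof -
  have "tstar (Nd A Lf) (Nd B Lf) = basis (Nd A (Nd B Lf))
      + lin (\<lambda>U. basis (Nd U Lf)) (tstar (Nd A Lf) B)" for A B
    by simp
  then show ?thesis
    unfolding over_Y star_def under_def bilin_def lin_lin lin_basis
    by (simp add: lin_add_fun)
qed

text \<open>The reflected identity: the \<open>tsucc\<close> part collapses to \<open>over\<close>,
  since the right factor has a trivial left branch.\<close>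

lemma Y_under_star_Y_under:
  "(Y \<setminus>\<^sub>D a) \<star>\<^sub>D (Y \<setminus>\<^sub>D b) = Y \<setminus>\<^sub>D (a \<star>\<^sub>D (Y \<setminus>\<^sub>D b)) + (Y \<setminus>\<^sub>D a) /\<^sub>D (Y \<setminus>\<^sub>D b)"
proof -
  have "tstar (Nd Lf A) (Nd Lf B) = lin (\<lambda>U. basis (Nd Lf U)) (tstar A (Nd Lf B))
      + basis (Nd (Nd Lf A) B)" for A B
    by simp
  then show ?thesis
    unfolding Y_under star_def over_def bilin_def lin_lin lin_basis
    by (simp add: lin_add_fun)
qed


section \<open>Principal ideals and filters of the Tamari poset\<close>

definition down :: "pbtree \<Rightarrow> (pbtree \<Rightarrow>\<^sub>0 'k::field)" where
  "down T = (\<Sum>S | tamari_le S T. basis S)"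

definition up :: "pbtree \<Rightarrow> (pbtree \<Rightarrow>\<^sub>0 'k::field)" where
  "up T = (\<Sum>S | tamari_le T S. basis S)"

lemma finite_ideal: "finite {S. tamari_le S T}"
  by (rule finite_subset[OF _ finite_trees[of "degree T"]])
    (auto simp: trees_def dest: tamari_le_degree)

lemma finite_filter: "finite {S. tamari_le T S}"
  by (rule finite_subset[OF _ finite_trees[of "degree T"]])
    (auto simp: trees_def dest: tamari_le_degree)

lemma lookup_down: "Poly_Mapping.lookup (down T) S = (if tamari_le S T then 1 else 0)"
  using finite_ideal[of T] by (simp add: down_def lookup_sum lookup_basis)

lemma lookup_up: "Poly_Mapping.lookup (up T) S = (if tamari_le T S then 1 else 0)"
  using finite_filter[of T] by (simp add: up_def lookup_sum lookup_basis)

lemma tamari_le_left: "tamari_le S S' \<Longrightarrow> tamari_le (Nd S T) (Nd S' T)"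
  unfolding tamari_le_def
  by (induction rule: rtranclp_induct) (auto intro: tamari_step.left rtranclp.rtrancl_into_rtrancl)

lemma tamari_le_right: "tamari_le T T' \<Longrightarrow> tamari_le (Nd S T) (Nd S T')"
  unfolding tamari_le_def
  by (induction rule: rtranclp_induct) (auto intro: tamari_step.right rtranclp.rtrancl_into_rtrancl)

lemma tamari_le_rotate: "tamari_le (Nd (Nd A B) C) (Nd A (Nd B C))"
  unfolding tamari_le_def by (blast intro: tamari_step.rotate)

lemma tamari_le_Lf: "tamari_le S Lf \<longleftrightarrow> S = Lf"
  using tamari_le_degree[of S Lf] tamari_le_refl by (cases S) auto

lemma down_Lf: "down Lf = basis Lf"
  by (simp add: down_def tamari_le_Lf)

text \<open>\<open>split k U = Some (A, B)\<close> expresses that \<open>degree A = k\<close> and that \<open>U\<close> occurs in the product of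
  \<open>Nd A Lf\<close> and \<open>B\<close>.\<close>

primrec split :: "nat \<Rightarrow> pbtree \<Rightarrow> (pbtree \<times> pbtree) option" where
  "split k Lf = None"
| "split k (Nd S T) =
     (if degree S = k then Some (S, T) else map_option (\<lambda>(A, B). (A, Nd B T)) (split k S))"

lemma split_degree: "split k U = Some (A, B) \<Longrightarrow> degree A = k \<and> degree U = k + degree B + 1"
  by (induction U arbitrary: B) (auto split: if_splits)

text \<open>Each node that \<open>split\<close> passes on its way down the left spine is one
  rotation, which moves that node into the right branch.\<close>

lemma split_le: "split k U = Some (A, B) \<Longrightarrow> tamari_le U (Nd A B)"
proof (induction U arbitrary: B)
  case (Nd S T)
  show ?case
  proof (cases "degree S = k")
    case True
    with Nd.prems show ?thesis by (simp add: tamari_le_refl)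
  next
    case False
    with Nd.prems obtain C where "split k S = Some (A, C)" "B = Nd C T" by auto
    with Nd.IH(1) show ?thesis
      by (blast intro: tamari_le_left tamari_le_rotate tamari_le_trans)
  qed
qed simp

text \<open>Splittings pull back along a step but need not push forward: a rotation can destroy the
  left-spine subtree of degree \<open>k\<close>. Under pulling back, the step either happens inside
  one of the two pieces or changes neither.\<close>

lemma split_step:
  assumes "tamari_step U U'" "split k U' = Some (A', B')"
  shows "\<exists>A B. split k U = Some (A, B) \<and> tamari_le A A' \<and> tamari_le B B'"
  using assms
proof (induction arbitrary: B' rule: tamari_step.induct)
  case (rotate A B C)
  \<comment> \<open>If the cut lies within \<open>A\<close>, then \<open>degree A > k\<close> by
    \<open>split_degree\<close>, so the node \<open>Nd A B\<close> is not the one cut off.\<close>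
  then show ?case
    by (auto split: if_splits intro: tamari_le_refl tamari_le_rotate dest: split_degree)
next
  case (left S S' T)
  have "degree S' = degree S" "tamari_le S S'"
    using left.hyps tamari_step_degree by (auto simp: tamari_le_def)
  with left.prems left.IH show ?case
    by (cases "degree S = k") (auto simp: tamari_le_refl intro!: tamari_le_left)
next
  case (right T T' S)
  then have "tamari_le T T'" by (auto simp: tamari_le_def)
  with right.prems show ?case
    by (auto split: if_splits intro: tamari_le_refl tamari_le_right)
qed

text \<open>On a path down from \<open>Nd S T\<close>, which splits as \<open>(S, T)\<close>, every
  tree splits by \<open>split_step\<close>. Conversely, \<open>split_le\<close> leads from
  \<open>U\<close> up to \<open>Nd A B\<close> and hence to \<open>Nd S T\<close>.\<close>

lemma tamari_le_Nd_iff: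
  "tamari_le U (Nd S T) \<longleftrightarrow>
     (\<exists>A B. split (degree S) U = Some (A, B) \<and> tamari_le A S \<and> tamari_le B T)"
proof
  assume "tamari_le U (Nd S T)"
  then have "tamari_step\<^sup>*\<^sup>* U (Nd S T)" by (simp add: tamari_le_def)
  then show "\<exists>A B. split (degree S) U = Some (A, B) \<and> tamari_le A S \<and> tamari_le B T"
  proof (induction rule: converse_rtranclp_induct)
    case base
    show ?case by (simp add: tamari_le_refl)
  next
    case (step U U')
    then show ?case using split_step by (meson tamari_le_trans)
  qed
next
  assume "\<exists>A B. split (degree S) U = Some (A, B) \<and> tamari_le A S \<and> tamari_le B T"
  then show "tamari_le U (Nd S T)"
    by (blast intro: split_le tamari_le_left tamari_le_right tamari_le_trans)
qed

lemma lookup_lin_Nd_right: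
  "Poly_Mapping.lookup (lin (\<lambda>V. basis (Nd V T)) a) U =
     (case U of Lf \<Rightarrow> 0 | Nd U1 U2 \<Rightarrow> if U2 = T then Poly_Mapping.lookup a U1 else 0)"
proof (cases U)
  case (Nd U1 U2)
  have "(\<Sum>x\<in>Poly_Mapping.keys a. Poly_Mapping.lookup a x * (if x = U1 then 1 else 0))
      = Poly_Mapping.lookup a U1"
    by (auto simp: in_keys_iff if_distrib cong: if_cong)
  with Nd show ?thesis
    by (simp add: lookup_lin[OF finite_keys order.refl] lookup_basis)
qed (simp add: lookup_lin[OF finite_keys order.refl] lookup_basis)

text \<open>Both sides recurse alike: the \<open>tprec\<close> term is the case where
  \<open>split\<close> stops at the root, the \<open>tsucc\<close> term the case where it enters the
  left branch.\<close>

lemma lookup_tstar_Nd_Lf: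
  "Poly_Mapping.lookup (tstar (Nd A Lf) B) U =
     (if split (degree A) U = Some (A, B) then 1 else 0)"
proof (induction B arbitrary: U)
  case Lf
  show ?case by (cases U) (auto simp: lookup_basis)
next
  case (Nd B1 B2)
  show ?case
  proof (cases U)
    case U: (Nd U1 U2)
    \<comment> \<open>The two cases exclude each other: a \<open>U1\<close> that splits has degree
      greater than that of \<open>A\<close>.\<close>
    show ?thesis
      using split_degree[of "degree A" U1 A B1]
      by (auto simp: U lookup_add lookup_lin_Nd_right Nd.IH(1) lookup_basis)
  qed (simp add: lookup_add lookup_lin_Nd_right lookup_basis)
qed

text \<open>Since \<open>split\<close> is a function, \<open>U\<close> occurs in the product of
  \<open>Nd A Lf\<close> and \<open>B\<close> for at most one pair \<open>(A, B)\<close> from the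
  two ideals. So the coefficients are 0 or 1, and \<open>tamari_le_Nd_iff\<close> decides
  which.\<close>

lemma down_Nd: "down (Nd S T) = (down S /\<^sub>D Y) \<star>\<^sub>D down T"
proof (rule poly_mapping_eqI)
  fix U
  \<comment> \<open>Because the order preserves degrees, the single splitting
    \<open>split (degree S) U\<close> serves all terms of the sum.\<close>
  have deg: "degree A = degree S" if "tamari_le A S" for A
    using that by (rule tamari_le_degree)
  have "Poly_Mapping.lookup ((down S /\<^sub>D Y) \<star>\<^sub>D down T) U
      = (\<Sum>A | tamari_le A S. \<Sum>B | tamari_le B T. Poly_Mapping.lookup (tstar (Nd A Lf) B) U :: 'a)"
    by (simp add: over_Y star_def bilin_def lin_lin down_def lin_sum lookup_sum)
  also have "\<dots> = (\<Sum>A | tamari_le A S. \<Sum>B | tamari_le B T.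
      if split (degree S) U = Some (A, B) then 1 else 0)"
    by (intro sum.cong refl) (simp add: lookup_tstar_Nd_Lf deg)
  also have "\<dots> = (\<Sum>p\<in>{A. tamari_le A S} \<times> {B. tamari_le B T}.
      if split (degree S) U = Some p then 1 else 0)"
    by (simp add: sum.cartesian_product case_prod_unfold)
  also have "\<dots> = (if tamari_le U (Nd S T) then 1 else 0)"
  proof (cases "split (degree S) U")
    case (Some p)
    then show ?thesis
      using finite_ideal by (cases p) (simp add: tamari_le_Nd_iff)
  qed (simp add: tamari_le_Nd_iff)
  finally show "(Poly_Mapping.lookup (down (Nd S T)) U :: 'a)
      = Poly_Mapping.lookup ((down S /\<^sub>D Y) \<star>\<^sub>D down T) U"
    by (simp only: lookup_down)
qed

text \<open>Associativity strips off the vertices on the right spine of \<open>S\<close>.\<close>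

lemma down_tree_under: "down (tree_under S T) = down S \<star>\<^sub>D down T"
  by (induction S) (simp_all add: down_Lf star_Lf_left down_Nd star_assoc)

text \<open>Here \<open>over_star\<close> moves the grafting past each vertex on the left spine of
  \<open>T\<close>.\<close>

lemma down_tree_over: "down (tree_over S T) = down S /\<^sub>D down T"
  by (induction T) (simp_all add: down_Lf over_Lf_right down_Nd over_star)

text \<open>Reflection of trees reverses the Tamari order, so statements on \<open>up\<close> reduce to \<open>down\<close>.\<close>

primrec mirror :: "pbtree \<Rightarrow> pbtree" where
  "mirror Lf = Lf"
| "mirror (Nd S T) = Nd (mirror T) (mirror S)"

lemma mirror_mirror [simp]: "mirror (mirror T) = T"
  by (induction T) auto

lemma mirror_tree_over: "mirror (tree_over S T) = tree_under (mirror T) (mirror S)"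
  by (induction T) auto

lemma mirror_tree_under: "mirror (tree_under S T) = tree_over (mirror T) (mirror S)"
  by (induction S) auto

lemma tamari_step_mirror: "tamari_step S T \<Longrightarrow> tamari_step (mirror T) (mirror S)"
  by (induction rule: tamari_step.induct) (auto intro: tamari_step.intros)

lemma tamari_le_mirror: "tamari_le (mirror S) (mirror T) \<longleftrightarrow> tamari_le T S"
proof -
  have "tamari_le (mirror T) (mirror S)" if "tamari_le S T" for S T
    using that unfolding tamari_le_def
    by (induction rule: rtranclp_induct)
      (auto intro: tamari_step_mirror converse_rtranclp_into_rtranclp)
  from this[of T S] this[of "mirror S" "mirror T"] show ?thesis by auto
qed

abbreviation mirror_lin :: "(pbtree \<Rightarrow>\<^sub>0 'k) \<Rightarrow> (pbtree \<Rightarrow>\<^sub>0 'k::field)" where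
  "mirror_lin \<equiv> lin (\<lambda>T. basis (mirror T))"

text \<open>The recursions for \<open>tprec\<close> and \<open>tsucc\<close> are reflections of one
  another.\<close>

lemma mirror_products:
  "mirror_lin (tprec S T :: _ \<Rightarrow>\<^sub>0 'k::field) = tsucc (mirror T) (mirror S)"
  "mirror_lin (tsucc S T :: _ \<Rightarrow>\<^sub>0 'k) = tprec (mirror T) (mirror S)"
  "mirror_lin (tstar S T :: _ \<Rightarrow>\<^sub>0 'k) = tstar (mirror T) (mirror S)"
proof (induction S T and S T and S T rule: tprec_tsucc_tstar.induct)
  case (1 S1 S2 T)
  then show ?case by (simp add: lin_lin flip: 1)
next
  case (3 S T1 T2)
  then show ?case by (simp add: lin_lin flip: 3)
next
  case (7 S1 S2 T1 T2)
  then show ?case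
    by (simp add: lin_add add.commute del: tprec.simps tsucc.simps)
qed auto

lemma up_mirror: "up (mirror T) = mirror_lin (down T)"
proof -
  have "bij_betw mirror {S. tamari_le S T} {S. tamari_le (mirror T) S}"
    by (rule bij_betw_byWitness[where f' = mirror])
      (auto simp: tamari_le_mirror, metis mirror_mirror tamari_le_mirror)
  then show ?thesis
    by (simp add: up_def down_def lin_sum sum.reindex_bij_betw[symmetric])
qed

lemma up_eq: "up T = mirror_lin (down (mirror T))"
  using up_mirror[of "mirror T"] by simp

lemma up_tree_over: "up (tree_over S T) = up S \<star>\<^sub>D up T"
proof -
  have "mirror_lin (a \<star>\<^sub>D b) = mirror_lin b \<star>\<^sub>D mirror_lin a" for a b :: "pbtree \<Rightarrow>\<^sub>0 'a"
    unfolding star_def bilin_def lin_lin lin_basis mirror_products by (rule lin_swap)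
  then show ?thesis by (simp add: up_eq mirror_tree_over down_tree_under)
qed

lemma up_tree_under: "up (tree_under S T) = up S \<setminus>\<^sub>D up T"
proof -
  have "mirror_lin (a /\<^sub>D b) = mirror_lin b \<setminus>\<^sub>D mirror_lin a" for a b :: "pbtree \<Rightarrow>\<^sub>0 'a"
    unfolding over_def under_def bilin_def lin_lin lin_basis mirror_tree_over by (rule lin_swap)
  then show ?thesis by (simp add: up_eq mirror_tree_under down_tree_over)
qed

lemma up_Lf: "up Lf = basis Lf"
  using up_eq[of Lf] by (simp add: down_Lf)

lemma down_Ytree: "down Ytree = Y"
  by (simp add: Ytree_def down_Nd down_Lf over_Lf_left star_Lf_right)

lemma up_Ytree: "up Ytree = Y"
  using up_mirror[of Ytree] by (simp add: down_Ytree) (simp add: Ytree_def)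

lemma up_Nd: "up (Nd S T) = up S \<star>\<^sub>D (Y \<setminus>\<^sub>D up T)"
proof -
  have "Nd S T = tree_over S (tree_under Ytree T)" by (simp add: Ytree_def)
  then show ?thesis by (simp only: up_tree_over up_tree_under up_Ytree)
qed


section \<open>The Coxeter transformation\<close>

lemma mat_apply_eq_lin:
  assumes "finite P" "a \<in> free_on P"
    and "\<And>v w. w \<in> P \<Longrightarrow> Poly_Mapping.lookup (f w) v = (if v \<in> P then M v w else 0)"
  shows "mat_apply P M a = lin f a"
proof (rule poly_mapping_eqI)
  fix v
  show "Poly_Mapping.lookup (mat_apply P M a) v = Poly_Mapping.lookup (lin f a) v"
    using assms by (auto simp: lookup_mat_apply lookup_lin[of P] free_on_def mult.commute)
qed

lemma mat_apply_down:
  "a \<in> kY n \<Longrightarrow> mat_apply (trees n) (incidence tamari_le) a = lin down a"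
  by (rule mat_apply_eq_lin[OF finite_trees])
    (auto simp: lookup_down incidence_def trees_def dest: tamari_le_degree)

lemma mat_apply_up:
  "a \<in> kY n \<Longrightarrow> mat_apply (trees n) (\<lambda>v w. incidence tamari_le w v) a = lin up a"
  by (rule mat_apply_eq_lin[OF finite_trees])
    (auto simp: lookup_up incidence_def trees_def dest: tamari_le_degree)

lemma bij_up: "bij_betw (lin up) (kY n) (kY n :: (pbtree \<Rightarrow>\<^sub>0 'k::field) set)"
  using bij_tamari_incidence_transpose[of n]
  by (rule bij_betw_cong[THEN iffD1, rotated]) (rule mat_apply_up)

lemma bij_down: "bij_betw (lin down) (kY n) (kY n :: (pbtree \<Rightarrow>\<^sub>0 'k::field) set)"
proof -
  \<comment> \<open>\<open>L\<close> is the transposed incidence matrix of the opposite order, so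
    the same invertibility result applies.\<close>
  have "bij_betw (mat_apply (trees n) (\<lambda>v w. incidence (\<lambda>x y. tamari_le y x) w v))
      (kY n) (kY n :: (pbtree \<Rightarrow>\<^sub>0 'k) set)"
    by (rule bij_incidence_transpose)
      (auto intro: finite_trees tamari_le_refl tamari_le_antisym tamari_le_trans)
  moreover have "(\<lambda>v w. incidence (\<lambda>x y. tamari_le y x) w v)
      = (incidence tamari_le :: _ \<Rightarrow> _ \<Rightarrow> 'k)"
    by (simp add: incidence_def fun_eq_iff)
  ultimately have "bij_betw (mat_apply (trees n) (incidence tamari_le))
      (kY n) (kY n :: (pbtree \<Rightarrow>\<^sub>0 'k) set)" by simp
  then show ?thesis
    by (rule bij_betw_cong[THEN iffD1, rotated]) (rule mat_apply_down)
qed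

lemma coxeter_up:
  assumes "b \<in> kY n"
  shows "coxeter (trees n) tamari_le (lin up b) = - lin down b"
proof -
  let ?f = "mat_apply (trees n) (\<lambda>v w. incidence tamari_le w v)"
  have "inv_into (kY n) ?f (lin up b) = b"
    unfolding mat_apply_up[OF assms, symmetric]
    by (rule bij_betw_inv_into_left[OF bij_tamari_incidence_transpose assms])
  then show ?thesis by (simp add: coxeter_def mat_apply_down[OF assms])
qed

text \<open>\<open>coxeter\<close> works in one degree at a time and hides its linearity behind
  \<open>inv_into\<close>. Gluing all degrees, 0 included, gives a map that is linear by
  construction and applies to products of different degrees.\<close>

definition theta :: "(pbtree \<Rightarrow>\<^sub>0 'k) \<Rightarrow> (pbtree \<Rightarrow>\<^sub>0 'k::field)" where
  "theta = lin (\<lambda>T. coxeter (trees (degree T)) tamari_le (basis T))"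

lemma basis_eq_lin_up: "\<exists>b\<in>kY (degree T). basis T = (lin up b :: pbtree \<Rightarrow>\<^sub>0 'k::field)"
  using bij_up[of "degree T", where ?'k = 'k] free_on_basis[of T "trees (degree T)"]
  by (auto simp: bij_betw_def trees_def image_iff)

lemma up_surj: "\<exists>b. (a :: pbtree \<Rightarrow>\<^sub>0 'k::field) = lin up b"
proof -
  from basis_eq_lin_up obtain g where "\<And>T. basis T = (lin up (g T) :: pbtree \<Rightarrow>\<^sub>0 'k)" by metis
  then have "a = lin up (lin g a)" by (simp add: lin_lin flip: \<open>\<And>T. basis T = lin up (g T)\<close>)
  then show ?thesis ..
qed

lemma coxeter_eq_theta:
  assumes "a \<in> kY n"
  shows "coxeter (trees n) tamari_le a = theta (a :: pbtree \<Rightarrow>\<^sub>0 'k::field)"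
proof -
  from basis_eq_lin_up obtain g
    where g: "\<And>T. g T \<in> kY (degree T)" "\<And>T. basis T = (lin up (g T) :: pbtree \<Rightarrow>\<^sub>0 'k)" by metis
  \<comment> \<open>Preimages under the transpose of \<open>L\<close>, chosen tree by tree, are
    extended linearly; this exposes the linearity of \<open>coxeter\<close>.\<close>
  have "lin g a \<in> kY n"
    using assms g(1) by (intro free_on_lin[OF assms]) (auto simp: trees_def)
  then have "coxeter (trees n) tamari_le (lin up (lin g a)) = - lin down (lin g a)"
    by (rule coxeter_up)
  also have "\<dots> = lin (\<lambda>T. - lin down (g T)) a"
    by (simp add: lin_lin lin_smul_fun flip: smul_minus_one)
  also have "\<dots> = theta a"
    unfolding theta_def using coxeter_up[OF g(1)] by (intro lin_cong) (simp add: g(2))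
  finally show ?thesis by (simp add: lin_lin flip: g(2))
qed

lemma theta_up: "theta (lin up b) = - lin down b"
proof -
  have "theta (up T) = (- down T :: pbtree \<Rightarrow>\<^sub>0 'a)" for T
  proof -
    have T: "(basis T :: pbtree \<Rightarrow>\<^sub>0 'a) \<in> kY (degree T)"
      by (rule free_on_basis) (simp add: trees_def)
    then have "up T \<in> (kY (degree T) :: (pbtree \<Rightarrow>\<^sub>0 'a) set)"
      using bij_up[of "degree T"] bij_betwE by fastforce
    then show ?thesis using coxeter_up[OF T] by (simp add: coxeter_eq_theta)
  qed
  then have "theta (lin up b) = lin (\<lambda>T. - down T) b"
    by (simp add: theta_def lin_lin)
  then show ?thesis by (simp add: lin_smul_fun flip: smul_minus_one)
qed

lemma theta_add: "theta (a + b) = theta a + theta b"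
  by (simp add: theta_def lin_add)

lemma theta_smul: "theta (smul c a) = smul c (theta a)"
  by (simp add: theta_def lin_smul)

text \<open>By \<open>up_surj\<close> it is enough to treat values of \<open>up\<close>, on which
  \<open>theta\<close> acts as \<open>- down\<close>; grafting is \<open>*\<close> for
  \<open>up\<close> and \<open>over\<close> for \<open>down\<close>. The signs of the two factors
  cancel, leaving the outer one.\<close>

lemma theta_star: "theta (a \<star>\<^sub>D b) = - (theta a /\<^sub>D theta b)"
proof -
  obtain a' b' where ab: "a = lin up a'" "b = lin up b'" using up_surj by metis
  have "a \<star>\<^sub>D b = lin up (a' /\<^sub>D b')"
    by (simp add: ab star_def over_def lin_bilin up_tree_over bilin_lin_lin)
  then have "theta (a \<star>\<^sub>D b) = - lin down (a' /\<^sub>D b')"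
    by (simp only: theta_up)
  then show ?thesis
    by (simp add: ab theta_up over_def lin_bilin down_tree_over bilin_lin_lin bilin_uminus)
qed

lemma theta_under: "theta (a \<setminus>\<^sub>D b) = - (theta a \<star>\<^sub>D theta b)"
proof -
  obtain a' b' where ab: "a = lin up a'" "b = lin up b'" using up_surj by metis
  have "a \<setminus>\<^sub>D b = lin up (a' \<setminus>\<^sub>D b')"
    by (simp add: ab under_def lin_bilin up_tree_under bilin_lin_lin)
  then have "theta (a \<setminus>\<^sub>D b) = - lin down (a' \<setminus>\<^sub>D b')"
    by (simp only: theta_up)
  then show ?thesis
    by (simp add: ab theta_up star_def under_def lin_bilin down_tree_under bilin_lin_lin
        bilin_uminus)
qed

lemma theta_uminus: "theta (- a) = - theta a"
  by (simp add: theta_def lin_uminus)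

lemma theta_lin: "theta (lin f a) = lin (\<lambda>T. theta (f T)) a"
  by (simp add: theta_def lin_lin)

lemma theta_up_tree: "theta (up T) = - down T"
  using theta_up[of "basis T"] by simp

lemma theta_Lf: "theta (basis Lf) = - basis Lf"
  using theta_up_tree[of Lf] by (simp add: up_Lf down_Lf)

lemma theta_Y: "theta Y = - Y"
  using theta_up_tree[of Ytree] by (simp add: up_Ytree down_Ytree)

text \<open>\<open>down (Nd A B) / Y\<close> is a difference of a \<open>star\<close> and an
  \<open>under\<close> of \<open>down A / Y\<close> and \<open>down B / Y\<close>.
  \<open>theta\<close> turns these into an \<open>over\<close> and a \<open>star\<close> of the
  values known by induction, and \<open>Y_under_star_Y_under\<close> recombines them.\<close>

lemma theta_down_over_Y:
  "theta (down T /\<^sub>D Y) = smul ((- 1) ^ (degree T + 1)) (Y \<setminus>\<^sub>D up T)"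
proof (induction T)
  case Lf
  show ?case
    by (simp add: down_Lf up_Lf over_Lf_left under_Lf_right theta_Y smul_minus_one)
next
  case (Nd A B)
  let ?x = "down A /\<^sub>D Y :: _ \<Rightarrow>\<^sub>0 'a" and ?p = "Y \<setminus>\<^sub>D up A :: _ \<Rightarrow>\<^sub>0 'a"
    and ?q = "Y \<setminus>\<^sub>D up B :: _ \<Rightarrow>\<^sub>0 'a"
  let ?s = "(- 1) ^ (degree A + 1) :: 'a" and ?t = "(- 1) ^ (degree B + 1) :: 'a"
  have "(?x \<star>\<^sub>D down B) /\<^sub>D Y = ?x \<star>\<^sub>D (down B /\<^sub>D Y) + - (?x \<setminus>\<^sub>D (down B /\<^sub>D Y))"
    by (simp add: over_Y_star_over_Y)
  then have "theta (down (Nd A B) /\<^sub>D Y) =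
      smul ?s ?p \<star>\<^sub>D smul ?t ?q + - (smul ?s ?p /\<^sub>D smul ?t ?q)"
    by (simp only: down_Nd theta_add theta_uminus theta_star theta_under Nd.IH minus_minus add.commute)
  also have "\<dots> = smul (?s * ?t) (?p \<star>\<^sub>D ?q + - (?p /\<^sub>D ?q))"
    by (simp add: star_def over_def bilin_smul_left bilin_smul_right smul_smul smul_add mult.commute
        flip: smul_minus_one)
  also have "?p \<star>\<^sub>D ?q + - (?p /\<^sub>D ?q) = Y \<setminus>\<^sub>D up (Nd A B)"
    by (simp add: Y_under_star_Y_under up_Nd)
  also have "?s * ?t = (- 1) ^ (degree (Nd A B) + 1)"
    by (simp add: power_add)
  finally show ?case .
qed

text \<open>As \<open>lin down\<close> is bijective, \<open>a\<close> can be expanded in the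
  \<open>down T\<close>. A second \<open>theta\<close> turns \<open>under\<close> into
  \<open>-\<close> \<open>star\<close> and \<open>up T\<close> into \<open>- down T\<close>, which
  lowers the sign exponent \<open>n + 1\<close> to \<open>n\<close>.\<close>

lemma theta_theta_over_Y:
  assumes "a \<in> kY n"
  shows "theta (theta (a /\<^sub>D Y)) = smul ((- 1) ^ n) (Y \<star>\<^sub>D (a :: pbtree \<Rightarrow>\<^sub>0 'k::field))"
proof -
  from assms bij_down[of n] obtain g where g: "g \<in> kY n" "a = lin down g"
    by (auto simp: bij_betw_def)
  have "theta (theta (a /\<^sub>D Y)) = lin (\<lambda>T. theta (theta (down T /\<^sub>D Y))) g"
    by (simp add: g(2) over_def bilin_lin_left theta_lin)
  also have "\<dots> = lin (\<lambda>T. smul ((- 1) ^ n) (Y \<star>\<^sub>D down T)) g"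
  proof (rule lin_cong)
    fix T assume "T \<in> Poly_Mapping.keys g"
    then have "degree T = n" using g(1) by (auto simp: free_on_def trees_def)
    then show "theta (theta (down T /\<^sub>D Y)) = smul ((- 1) ^ n) (Y \<star>\<^sub>D down T :: _ \<Rightarrow>\<^sub>0 'k)"
      by (simp add: theta_down_over_Y theta_smul theta_uminus theta_under theta_Y theta_up_tree star_def
          bilin_uminus smul_uminus_left smul_uminus_right)
  qed
  also have "\<dots> = smul ((- 1) ^ n) (Y \<star>\<^sub>D a)"
    by (simp add: lin_smul_fun g(2) star_def bilin_lin_right)
  finally show ?thesis .
qed

text \<open>Applied twice, \<open>theta\<close> carries \<open>under\<close> to \<open>star\<close>
  and then to \<open>over\<close>, and the two outer signs cancel; the remaining sign comes from the
  left branch.\<close>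

lemma theta_theta_Nd:
  "theta (theta (basis (Nd S T))) =
     smul ((- 1) ^ degree S) ((Y \<star>\<^sub>D basis S) /\<^sub>D theta (theta (basis T)) :: _ \<Rightarrow>\<^sub>0 'k::field)"
proof -
  have "basis (Nd S T) = (basis S /\<^sub>D Y) \<setminus>\<^sub>D (basis T :: _ \<Rightarrow>\<^sub>0 'k)"
    by (simp add: over_Y under_def)
  moreover have "(basis S :: _ \<Rightarrow>\<^sub>0 'k) \<in> kY (degree S)"
    by (rule free_on_basis) (simp add: trees_def)
  ultimately show ?thesis
    by (simp add: theta_under theta_star theta_uminus theta_theta_over_Y over_smul_left)
qed


section \<open>The anticyclic structure\<close>

text \<open>The first argument of the operation \<open>T\<close> sits at the bottom of the left
  spine, so \<open>w / Y\<close> in that place grafts \<open>w\<close> on the leftmost leaf of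
  \<open>T\<close>.\<close>

lemma act_over_Y:
  "T \<noteq> Lf \<Longrightarrow> act T ((replicate (degree T) Y)[0 := w /\<^sub>D Y]) = w /\<^sub>D basis T"
proof (induction T)
  case (Nd S T)
  let ?xs = "(replicate (degree (Nd S T)) Y)[0 := w /\<^sub>D Y]"
  have drop: "act T (drop (degree S + 1) ?xs) = basis T"
    by (simp add: drop_update_cancel act_Ytree del: replicate_Suc)
  show ?case
  proof (cases "S = Lf")
    \<comment> \<open>With an empty left branch, the argument of index 0 is the root vertex itself;
      otherwise it is passed on to \<open>S\<close>.\<close>
    case True
    then show ?thesis
      using drop by (simp add: over_Y prec_def succ_def bilin_lin_left bilin_lin_right)
        (simp add: over_def bilin_basis_right)
  next
    case False
    then have "degree S > 0" by (cases S) auto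
    moreover have "take (degree S) ?xs = (replicate (degree S) Y)[0 := w /\<^sub>D Y]"
      by (simp add: take_update_swap min_def del: replicate_Suc)
    ultimately have "act (Nd S T) ?xs = ((w /\<^sub>D basis S) \<succ>\<^sub>D Y) \<prec>\<^sub>D basis T"
      using drop Nd.IH(1)[OF False] by (simp del: replicate_Suc degree.simps) (simp del: replicate_Suc)
    then show ?thesis
      by (simp add: over_def prec_def succ_def Ytree_def bilin_basis_right lin_lin)
  qed
qed simp

lemma pcomp_over_Y:
  assumes "\<mu> \<in> kYplus"
  shows "pcomp \<mu> 1 (w /\<^sub>D Y) = w /\<^sub>D \<mu>"
proof -
  have "pcomp \<mu> 1 (w /\<^sub>D Y) = lin (\<lambda>T. w /\<^sub>D basis T) \<mu>"
    unfolding pcomp_def diff_self_eq_0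
    by (rule lin_cong, rule act_over_Y) (use assms in \<open>auto simp: free_on_def\<close>)
  also have "\<dots> = w /\<^sub>D \<mu>"
    using bilin_lin_right[of "\<lambda>S T. basis (tree_over S T)" w basis \<mu>] by (simp add: over_def)
  finally show ?thesis .
qed

lemma linear_endo_on_eq_lin:
  fixes a :: "'a \<Rightarrow>\<^sub>0 'k::field"
  assumes "linear_endo_on smul (free_on P) f" "a \<in> free_on P"
  shows "f a = lin (\<lambda>x. f (basis x)) a"
proof -
  have "f (\<Sum>x\<in>A. smul (c x) (basis x)) = (\<Sum>x\<in>A. smul (c x) (f (basis x)))"
    if "finite A" "A \<subseteq> P" for A c
    using that
  proof (induction A)
    case empty
    \<comment> \<open>\<open>linear_endo_on\<close> has no clause for zero; \<open>f 0 = 0\<close>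
      comes from the scalar 0.\<close>
    have "f (smul 0 0) = smul 0 (f 0)"
      using assms(1) free_on_zero unfolding linear_endo_on_def by blast
    moreover have "smul 0 (f 0) = 0" by (rule poly_mapping_eqI) simp
    ultimately show ?case by simp
  next
    case (insert x A)
    have "smul (c x) (basis x) \<in> free_on P" "(\<Sum>x\<in>A. smul (c x) (basis x)) \<in> free_on P"
      "(basis x :: _ \<Rightarrow>\<^sub>0 'k) \<in> free_on P"
      using insert.prems by (auto intro!: free_on_smul free_on_basis free_on_sum)
    moreover from this have "f (smul (c x) (basis x)) = smul (c x) (f (basis x))"
      using assms(1) by (simp add: linear_endo_on_def)
    ultimately show ?case
      using insert assms(1) by (simp add: linear_endo_on_def)
  qed
  from this[of "Poly_Mapping.keys a" "Poly_Mapping.lookup a"] assms(2) show ?thesis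
    by (simp add: free_on_def flip: lin_def)
qed

section \<open>Compositions with the generators, and the values of \<open>\<tau>\<close> on
  trees\<close>

lemma at_Y_binary:
  "at_Y (Prec Ident Ident) = basis (tree_under Ytree Ytree)"
  "at_Y (Succ Ident Ident) = basis (tree_over Ytree Ytree)"
  by (simp_all add: at_Y_simps prec_def succ_def Ytree_def)

text \<open>A monomial representing \<open>S\<close> reduces each composition to a grafting of
  monomials.\<close>

lemma pcomp_generators:
  assumes "S \<noteq> Lf"
  shows "pcomp (basis (tree_over Ytree Ytree)) 1 (basis S) = (basis (Nd S Lf) :: _ \<Rightarrow>\<^sub>0 'k::field)"
    and "pcomp (basis (tree_over Ytree Ytree)) 2 (basis S) = (Y \<succ>\<^sub>D basis S :: _ \<Rightarrow>\<^sub>0 'k)"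
    and "pcomp (basis (tree_under Ytree Ytree)) 2 (basis S) = (Y \<prec>\<^sub>D basis S :: _ \<Rightarrow>\<^sub>0 'k)"
proof -
  obtain s where s: "at_Y s = (basis S :: _ \<Rightarrow>\<^sub>0 'k)" using at_Y_surj[OF assms] by blast
  show "pcomp (basis (tree_over Ytree Ytree)) 1 (basis S) = (basis (Nd S Lf) :: _ \<Rightarrow>\<^sub>0 'k)"
    using pcomp_monomial[of 1 "Succ Ident Ident" s, where ?'a = 'k]
    by (simp add: at_Y_binary s) (simp add: at_Y_simps s succ_def Ytree_def)
  show "pcomp (basis (tree_over Ytree Ytree)) 2 (basis S) = (Y \<succ>\<^sub>D basis S :: _ \<Rightarrow>\<^sub>0 'k)"
    using pcomp_monomial[of 2 "Succ Ident Ident" s, where ?'a = 'k]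
    by (simp add: at_Y_binary s) (simp add: at_Y_simps s)
  show "pcomp (basis (tree_under Ytree Ytree)) 2 (basis S) = (Y \<prec>\<^sub>D basis S :: _ \<Rightarrow>\<^sub>0 'k)"
    using pcomp_monomial[of 2 "Prec Ident Ident" s, where ?'a = 'k]
    by (simp add: at_Y_binary s) (simp add: at_Y_simps s)
qed

text \<open>\<open>Nd S Lf\<close> is \<open>S\<close> inserted in slot 1 of \<open>Y / Y\<close>.
  The inner axiom moves \<open>S\<close> to slot 2 of the image of \<open>Y / Y\<close>, whose two
  terms there yield the two halves of \<open>Y * S\<close>; for \<open>S = Lf\<close> this is the
  unit axiom.\<close>

lemma anticyclic_Nd_Lf:
  assumes "anticyclic_structure smul kY Y pcomp \<tau>"
    and over: "\<tau> 2 (basis (tree_over Ytree Ytree)) =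
      - (basis (tree_under Ytree Ytree) + basis (tree_over Ytree Ytree))"
  shows "\<tau> (degree S + 1) (basis (Nd S Lf)) = - (Y \<star>\<^sub>D (basis S :: _ \<Rightarrow>\<^sub>0 'k::field))"
proof (cases "S = Lf")
  case True
  interpret anticyclic_structure smul kY Y pcomp \<tau> by fact
  show ?thesis using True unit by (simp add: star_Lf_right) (simp add: Ytree_def)
next
  case False
  interpret anticyclic_structure smul kY Y pcomp \<tau> by fact
  have "(basis (tree_over Ytree Ytree) :: _ \<Rightarrow>\<^sub>0 'k) \<in> kY 2"
    "(basis S :: _ \<Rightarrow>\<^sub>0 'k) \<in> kY (degree S)" "1 \<le> degree S"
    using False by (auto intro!: free_on_basis simp: trees_def Ytree_def) (cases S, auto)
  then have "\<tau> (2 + degree S - 1) (pcomp (basis (tree_over Ytree Ytree)) 1 (basis S))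
      = pcomp (\<tau> 2 (basis (tree_over Ytree Ytree))) (1 + 1) (basis S)"
    by (intro comp_inner) auto
  then have "\<tau> (degree S + 1) (basis (Nd S Lf))
      = pcomp (\<tau> 2 (basis (tree_over Ytree Ytree))) 2 (basis S)"
    by (simp only: pcomp_generators(1)[OF False] one_add_one) (simp add: numeral_2_eq_2)
  also have "\<dots> = - (Y \<prec>\<^sub>D basis S + Y \<succ>\<^sub>D basis S)"
    by (simp only: over pcomp_generators(2,3)[OF False, symmetric]) (simp only: pcomp_def lin_uminus lin_add)
  also have "\<dots> = - (Y \<star>\<^sub>D basis S)"
    using False by (simp add: star_eq free_on_basis Ytree_def)
  finally show ?thesis .
qed

text \<open>\<open>Nd S R\<close> is the \<open>tprec\<close> product of \<open>Nd S Lf\<close> and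
  \<open>R\<close>. It is built by putting \<open>Nd S Lf\<close> in slot 1 of the generator and
  then \<open>R\<close> in the last slot, so that the inner axiom evaluates the first step and the
  last-slot axiom the second.\<close>

lemma anticyclic_Nd:
  assumes "anticyclic_structure smul kY Y pcomp \<tau>"
    and under: "\<tau> 2 (basis (tree_under Ytree Ytree)) = basis (tree_over Ytree Ytree)"
    and "R \<noteq> Lf"
  shows "\<tau> (degree S + degree R + 1) (basis (Nd S R)) =
    - ((Y \<star>\<^sub>D basis S) /\<^sub>D \<tau> (degree R) (basis R :: _ \<Rightarrow>\<^sub>0 'k::field))"
proof -
  interpret anticyclic_structure smul kY Y pcomp \<tau> by fact
  let ?m = "degree S + 1" and ?x = "basis (Nd S Lf) :: _ \<Rightarrow>\<^sub>0 'k"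
    and ?y = "basis R :: _ \<Rightarrow>\<^sub>0 'k" and ?P = "basis (tree_under Ytree Ytree) :: _ \<Rightarrow>\<^sub>0 'k"
  have R: "1 \<le> degree R" using \<open>R \<noteq> Lf\<close> by (cases R) auto
  obtain s where s: "arity s = ?m" "at_Y s = ?x"
    using at_Y_surj[of "Nd S Lf", where ?'a = 'k] by auto
  obtain r where r: "arity r = degree R" "at_Y r = ?y"
    using at_Y_surj[OF \<open>R \<noteq> Lf\<close>] by blast
  have mem: "?P \<in> kY 2" "?x \<in> kY ?m" "?y \<in> kY (degree R)"
    by (auto intro!: free_on_basis simp: trees_def Ytree_def)
  have eq: "pcomp ?P 1 ?x = at_Y (Prec s Ident)"
    using pcomp_monomial[of 1 "Prec Ident Ident" s, where ?'a = 'k] by (simp add: at_Y_binary s)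
  have in1: "pcomp ?P 1 ?x \<in> kY (?m + 1)"
    using at_Y_in_kY[of "Prec s Ident", where ?'k = 'k] by (simp only: eq arity.simps s)
  have "\<tau> (?m + 1) (pcomp ?P 1 ?x) = pcomp (basis (tree_over Ytree Ytree)) 2 ?x"
  proof -
    have "\<tau> (2 + ?m - 1) (pcomp ?P 1 ?x) = pcomp (\<tau> 2 ?P) (1 + 1) ?x"
      using mem by (intro comp_inner) auto
    then show ?thesis by (simp only: under one_add_one) (simp add: numeral_2_eq_2)
  qed
  \<comment> \<open>The left branch of \<open>Y \<succ>\<^sub>D basis (Nd S Lf)\<close> is
    \<open>Y * S\<close>; this is the shape that \<open>pcomp_over_Y\<close> accepts.\<close>
  also have "\<dots> = (Y \<star>\<^sub>D basis S) /\<^sub>D Y"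
    unfolding over_Y by (simp add: pcomp_generators(2)) (simp add: succ_def star_def Ytree_def)
  finally have inner: "\<tau> (?m + 1) (pcomp ?P 1 ?x) = (Y \<star>\<^sub>D basis S) /\<^sub>D Y" .
  have "basis (Nd S R) = ?x \<prec>\<^sub>D ?y"
    by (simp add: prec_def)
  also have "\<dots> = pcomp (pcomp ?P 1 ?x) (?m + 1) ?y"
    using pcomp_monomial[of "?m + 1" "Prec s Ident" r, where ?'a = 'k]
    unfolding eq by (simp add: s r) (simp add: at_Y_simps s r)
  finally have Nd: "basis (Nd S R) = pcomp (pcomp ?P 1 ?x) (?m + 1) ?y" .
  have "\<tau> (degree S + degree R + 1) (basis (Nd S R))
      = - pcomp (\<tau> (degree R) ?y) 1 ((Y \<star>\<^sub>D basis S) /\<^sub>D Y)"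
  proof -
    have "\<tau> (?m + 1 + degree R - 1) (pcomp (pcomp ?P 1 ?x) (?m + 1) ?y)
        = - pcomp (\<tau> (degree R) ?y) 1 (\<tau> (?m + 1) (pcomp ?P 1 ?x))"
      using in1 mem R by (intro comp_last) auto
    then have "\<tau> (?m + 1 + degree R - 1) (basis (Nd S R))
        = - pcomp (\<tau> (degree R) ?y) 1 ((Y \<star>\<^sub>D basis S) /\<^sub>D Y)"
      by (simp only: inner Nd)
    then show ?thesis by (simp add: add_ac)
  qed
  \<comment> \<open>\<open>\<tau>\<close> preserves the degree, which is positive for
    \<open>R\<close>, so \<open>pcomp_over_Y\<close> applies.\<close>
  also have "\<tau> (degree R) ?y \<in> kYplus"
  proof -
    have "\<tau> (degree R) ?y \<in> kY (degree R)"
      using linear[OF R] mem by (simp add: linear_endo_on_def)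
    then show ?thesis using R by (force simp: free_on_def trees_def)
  qed
  then have "pcomp (\<tau> (degree R) ?y) 1 ((Y \<star>\<^sub>D basis S) /\<^sub>D Y)
      = (Y \<star>\<^sub>D basis S) /\<^sub>D \<tau> (degree R) ?y"
    by (rule pcomp_over_Y)
  finally show ?thesis .
qed

text \<open>\<open>\<tau>\<close> and the signed square of \<open>theta\<close> obey the same
  recursion along the right spine. It ends at \<open>R = Lf\<close>, which \<open>theta\<close>
  applied twice fixes.\<close>

lemma anticyclic_basis:
  assumes "anticyclic_structure smul kY Y pcomp \<tau>"
    and "\<tau> 2 (basis (tree_under Ytree Ytree)) = basis (tree_over Ytree Ytree)"
    and "\<tau> 2 (basis (tree_over Ytree Ytree)) =
      - (basis (tree_under Ytree Ytree) + basis (tree_over Ytree Ytree))"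
    and "T \<noteq> Lf"
  shows "\<tau> (degree T) (basis T :: _ \<Rightarrow>\<^sub>0 'k::field) =
    smul ((- 1) ^ degree T) (theta (theta (basis T)))"
  using assms(4)
proof (induction T)
  case (Nd S R)
  have sgn: "smul ((- 1) ^ d) (smul ((- 1) ^ d) b) = b" for d and b :: "pbtree \<Rightarrow>\<^sub>0 'k"
    by (simp add: smul_smul flip: power_mult_distrib)
  show ?case
  proof (cases "R = Lf")
    case True
    then show ?thesis
      using anticyclic_Nd_Lf[OF assms(1,3), of S]
      by (simp add: theta_theta_Nd theta_Lf theta_uminus over_Lf_right smul_uminus_left sgn)
  next
    case False
    then have "\<tau> (degree (Nd S R)) (basis (Nd S R)) = - ((Y \<star>\<^sub>D basis S) /\<^sub>D
        smul ((- 1) ^ degree R) (theta (theta (basis R))))"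
      using anticyclic_Nd[OF assms(1,2), of R S] Nd.IH(2) by simp
    then show ?thesis
      by (simp add: theta_theta_Nd over_def bilin_smul_right smul_uminus_left power_add)
        (simp add: sgn mult.commute flip: smul_smul)
  qed
qed simp

theorem theorem6p1:
  fixes \<tau> :: "nat \<Rightarrow> (pbtree \<Rightarrow>\<^sub>0 'k::field) \<Rightarrow> (pbtree \<Rightarrow>\<^sub>0 'k)"
  assumes "anticyclic_structure smul kY (basis Ytree) pcomp \<tau>"
    and "\<tau> 2 (basis (tree_under Ytree Ytree)) = basis (tree_over Ytree Ytree)"
    and "\<tau> 2 (basis (tree_over Ytree Ytree)) =
           - (basis (tree_under Ytree Ytree) + basis (tree_over Ytree Ytree))"
    and "n \<ge> 1" and "a \<in> kY n"
  shows "\<tau> n a = smul ((- 1) ^ n) ((coxeter (trees n) tamari_le ^^ 2) a)"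
proof -
  interpret anticyclic_structure smul kY "basis Ytree" pcomp \<tau> by fact
  let ?c = "coxeter (trees n) tamari_le :: (pbtree \<Rightarrow>\<^sub>0 'k) \<Rightarrow> _"
  have "\<tau> n a = lin (\<lambda>T. \<tau> n (basis T)) a"
    using linear[OF \<open>n \<ge> 1\<close>] \<open>a \<in> kY n\<close> by (rule linear_endo_on_eq_lin)
  also have "\<dots> = lin (\<lambda>T. smul ((- 1) ^ n) (theta (theta (basis T)))) a"
  proof (rule lin_cong)
    fix T assume "T \<in> Poly_Mapping.keys a"
    then have "degree T = n" using \<open>a \<in> kY n\<close> by (auto simp: free_on_def trees_def)
    then show "\<tau> n (basis T) = smul ((- 1) ^ n) (theta (theta (basis T)) :: _ \<Rightarrow>\<^sub>0 'k)"
      using anticyclic_basis[OF assms(1-3), of T] \<open>n \<ge> 1\<close> by (cases "T = Lf") auto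
  qed
  also have "\<dots> = smul ((- 1) ^ n) (theta (theta a))"
    by (simp add: lin_smul_fun flip: theta_lin)
  also have "theta (theta a) = ?c (?c a)"
  proof -
    \<comment> \<open>The result stays in degree \<open>n\<close>, so
      \<open>coxeter_eq_theta\<close> can be used a second time.\<close>
    have "?c a \<in> kY n"
      using free_on_smul[OF mat_apply_in_free_on[OF finite_trees], of "- 1"]
      by (simp add: coxeter_def smul_minus_one)
    then show ?thesis using \<open>a \<in> kY n\<close> by (simp add: coxeter_eq_theta)
  qed
  finally show ?thesis by (simp add: numeral_2_eq_2)
qed

end
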